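(* Let $p>2$. Suppose there is a polynomial-time algorithm which, for every $\tau\in[0,1]$, is an $(\alpha, \beta)$-approximation algorithm for the $\tau$-TC problem, where $\alpha, \beta\in(0,1]$ are independent of $\tau$ (e.g., constants). Then there exists a polynomial-time $\Omega\left(\frac{\alpha^{1/2-1/p}\, \beta^{1/p}}{\log^{1/p} n}\right)$-approximation algorithm for the $2 \mapsto p$ norm problem on matrices $A\in\mathbb{R}^{n\times d}$ ($n\ge2$).
   Context: For $p,q\ge1$ and $A\in\mathbb{R}^{n\times d}$, the $q\mapsto p$ norm is $\|A\|_{q\mapsto p}=\max_{x\in\mathbb{R}^d,\,x\ne0}\frac{\|Ax\|_p}{\|x\|_q}$, where $\|\cdot\|_p$ is the $\ell_p$ norm. A $\theta$-approximation ($\theta>0$) to the $q\mapsto p$ norm problem is an algorithm that, given $A$, outputs a nonzero vector $x$ with $\frac{\|Ax\|_p}{\|x\|_q}\ge\theta\,\|A\|_{q\mapsto p}$. The $\tau$-TC (threshold correlation) problem: given vectors $v_1,\dots,v_n$ in the closed Euclidean unit ball of $\mathbb{R}^d$, non-negative weights $w_1,\dots,w_n$, and a threshold $\tau\in[0,1]$, find a unit vector $x\in\mathbb{R}^d$ maximizing $\sum_{i\in[n]} \mathbf{1}[\langle x,v_i\rangle^2\ge\tau]\, w_i\langle x,v_i\rangle^2$. Let $\mathrm{Opt}$ denote the maximum value. For $0\le\alpha,\beta\le1$, an $(\alpha,\beta)$-approximation algorithm is one that returns a unit vector $x\in\mathbb{R}^d$ with $\sum_{i\in[n]} \mathbf{1}[\langle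 x,v_i\rangle^2\ge\alpha\tau]\, w_i\langle x,v_i\rangle^2\ge\beta\cdot\mathrm{Opt}$. *)

theory Defs
  imports
    Complex_Main
    "HOL-Computational_Algebra.Polynomial"
    "Jordan_Normal_Form.Matrix"
begin

section \<open>A real random access machine\<close>

text \<open>
  Inputs and outputs are real numbers, so algorithms are programs of a real RAM in the sense of
  Blum, Shub and Smale / Preparata and Shamos: a real number occupies one memory cell, exact
  arithmetic, square roots and comparisons of reals have unit cost, and a program contains finitely
  many real constants. The machine also has natural numbers for indexing and counting.

  Two restrictions keep unit cost honest: there is no conversion from reals to naturals (no
  rounding), and there is no multiplication of naturals, so that a natural number computed in
  \<open>t\<close> steps has only \<open>O(t)\<close> more bits than the input dimensions.

  The memory consists of arrays, named by natural numbers, of unbounded length. As usual in HOL,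
  \<open>x / 0 = 0\<close>, \<open>sqrt (- x) = - sqrt x\<close>, and subtraction of naturals is truncated.
\<close>

record mem =
  nats :: "nat \<Rightarrow> nat \<Rightarrow> nat"
  reals :: "nat \<Rightarrow> nat \<Rightarrow> real"

datatype nexp =
    NConst nat
  | NCell nat nexp
  | NAdd nexp nexp
  | NSub nexp nexp

datatype rexp =
    RConst real
  | RCell nat nexp
  | ROfNat nexp
  | RAdd rexp rexp
  | RSub rexp rexp
  | RMul rexp rexp
  | RDiv rexp rexp
  | RSqrt rexp

datatype bexp =
    NLess nexp nexp
  | RLess rexp rexp
  | BNot bexp
  | BAnd bexp bexp

datatype com =
    Skip
  | NSet nat nexp nexp
  | RSet nat nexp rexp
  | NClear nat
  | RClear nat
  | Seq com com
  | If bexp com com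
  | While bexp com

primrec nval :: "nexp \<Rightarrow> mem \<Rightarrow> nat" where
  "nval (NConst k) s = k"
| "nval (NCell a e) s = nats s a (nval e s)"
| "nval (NAdd e f) s = nval e s + nval f s"
| "nval (NSub e f) s = nval e s - nval f s"

primrec rval :: "rexp \<Rightarrow> mem \<Rightarrow> real" where
  "rval (RConst r) s = r"
| "rval (RCell a e) s = reals s a (nval e s)"
| "rval (ROfNat e) s = real (nval e s)"
| "rval (RAdd e f) s = rval e s + rval f s"
| "rval (RSub e f) s = rval e s - rval f s"
| "rval (RMul e f) s = rval e s * rval f s"
| "rval (RDiv e f) s = rval e s / rval f s"
| "rval (RSqrt e) s = sqrt (rval e s)"

primrec bval :: "bexp \<Rightarrow> mem \<Rightarrow> bool" where
  "bval (NLess e f) s \<longleftrightarrow> nval e s < nval f s"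
| "bval (RLess e f) s \<longleftrightarrow> rval e s < rval f s"
| "bval (BNot b) s \<longleftrightarrow> \<not> bval b s"
| "bval (BAnd b c) s \<longleftrightarrow> bval b s \<and> bval c s"

definition nset :: "nat \<Rightarrow> nat \<Rightarrow> nat \<Rightarrow> mem \<Rightarrow> mem" where
  "nset a i k s = s\<lparr>nats := (nats s)(a := (nats s a)(i := k))\<rparr>"

definition rset :: "nat \<Rightarrow> nat \<Rightarrow> real \<Rightarrow> mem \<Rightarrow> mem" where
  "rset a i r s = s\<lparr>reals := (reals s)(a := (reals s a)(i := r))\<rparr>"

text \<open>
  \<open>exec c s t s'\<close>: started in memory \<open>s\<close>, program \<open>c\<close> halts after \<open>t\<close> steps in memory \<open>s'\<close>.
  Expressions have fixed size in a given program, so evaluating one inside a command only costs a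
  constant factor. Clearing stands for allocating a fresh zero array; it is charged one step, since
  it can be amortised against the earlier writes to the array.
\<close>

inductive exec :: "com \<Rightarrow> mem \<Rightarrow> nat \<Rightarrow> mem \<Rightarrow> bool" where
  Skip: "exec Skip s 1 s"
| NSet: "exec (NSet a e f) s 1 (nset a (nval e s) (nval f s) s)"
| RSet: "exec (RSet a e f) s 1 (rset a (nval e s) (rval f s) s)"
| NClear: "exec (NClear a) s 1 (s\<lparr>nats := (nats s)(a := (\<lambda>_. 0))\<rparr>)"
| RClear: "exec (RClear a) s 1 (s\<lparr>reals := (reals s)(a := (\<lambda>_. 0))\<rparr>)"
| Seq: "exec c s t s' \<Longrightarrow> exec d s' t' s'' \<Longrightarrow> exec (Seq c d) s (t + t') s''"
| IfTrue: "bval b s \<Longrightarrow> exec c s t s' \<Longrightarrow> exec (If b c d) s (t + 1) s'"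
| IfFalse: "\<not> bval b s \<Longrightarrow> exec d s t s' \<Longrightarrow> exec (If b c d) s (t + 1) s'"
| WhileFalse: "\<not> bval b s \<Longrightarrow> exec (While b c) s 1 s"
| WhileTrue: "bval b s \<Longrightarrow> exec c s t s' \<Longrightarrow> exec (While b c) s' t' s'' \<Longrightarrow>
    exec (While b c) s (t + t' + 1) s''"

inductive_cases SkipE: "exec Skip s t s'"
  and NSetE: "exec (NSet a e f) s t s'"
  and RSetE: "exec (RSet a e f) s t s'"
  and NClearE: "exec (NClear a) s t s'"
  and RClearE: "exec (RClear a) s t s'"
  and SeqE: "exec (Seq c d) s t s'"
  and IfE: "exec (If b c d) s t s'"
  and WhileE: "exec (While b c) s t s'"

lemma exec_deterministic: "exec c s t s' \<Longrightarrow> exec c s u s'' \<Longrightarrow> t = u \<and> s' = s''"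
proof (induction arbitrary: u s'' rule: exec.induct)
  case (Seq c s t s1 d t' s2)
  from Seq.prems obtain t1 m t2 where "exec c s t1 m" "exec d m t2 s''" "u = t1 + t2"
    by (rule SeqE)
  with Seq.IH show ?case by blast
next
  case (IfTrue b s c t s1 d)
  from IfTrue.prems IfTrue.hyps(1) obtain t1 where "exec c s t1 s''" "u = t1 + 1"
    by (auto elim: IfE)
  with IfTrue.IH show ?case by blast
next
  case (IfFalse b s d t s1 c)
  from IfFalse.prems IfFalse.hyps(1) obtain t1 where "exec d s t1 s''" "u = t1 + 1"
    by (auto elim: IfE)
  with IfFalse.IH show ?case by blast
next
  case (WhileTrue b s c t s1 t' s2)
  from WhileTrue.prems WhileTrue.hyps(1) obtain t1 m t2
    where "exec c s t1 m" "exec (While b c) m t2 s''" "u = t1 + t2 + 1"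
    by (auto elim: WhileE)
  with WhileTrue.IH show ?case by blast
qed (erule SkipE NSetE RSetE NClearE RClearE WhileE; simp)+

text \<open>
  Natural array 0 initially holds the dimensions \<open>n\<close> and \<open>d\<close> (cells 0 and 1), the real arrays hold
  \<open>R\<close>, and all other cells are 0. The result is read off the first \<open>d\<close> cells of real array 3.
\<close>

definition input_mem :: "nat \<Rightarrow> nat \<Rightarrow> (nat \<Rightarrow> nat \<Rightarrow> real) \<Rightarrow> mem" where
  "input_mem n d R = \<lparr>nats = (\<lambda>_ _. 0)(0 := (\<lambda>_. 0)(0 := n, 1 := d)), reals = R\<rparr>"

definition output_vec :: "nat \<Rightarrow> mem \<Rightarrow> real vec" where
  "output_vec d s = vec d (\<lambda>j. reals s 3 j)"


section \<open>The \<open>q \<mapsto> p\<close> norm problem\<close>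

definition lp_norm :: "real \<Rightarrow> real vec \<Rightarrow> real" where
  "lp_norm p x = (\<Sum>i<dim_vec x. \<bar>x $ i\<bar> powr p) powr (1 / p)"

text \<open>The maximum is written as a supremum; by compactness it is attained when there is at least
  one column.\<close>

definition op_norm :: "real \<Rightarrow> real \<Rightarrow> real mat \<Rightarrow> real" where
  "op_norm q p A =
    (SUP x \<in> {x \<in> carrier_vec (dim_col A). x \<noteq> 0\<^sub>v (dim_col A)}. lp_norm p (A *\<^sub>v x) / lp_norm q x)"

definition norm_approx :: "real \<Rightarrow> real \<Rightarrow> real \<Rightarrow> real mat \<Rightarrow> real vec \<Rightarrow> bool" where
  "norm_approx q p \<theta> A x \<longleftrightarrow>
    x \<in> carrier_vec (dim_col A) \<and> x \<noteq> 0\<^sub>v (dim_col A) \<and>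
    lp_norm p (A *\<^sub>v x) / lp_norm q x \<ge> \<theta> * op_norm q p A"

definition norm_input :: "nat \<Rightarrow> nat \<Rightarrow> real mat \<Rightarrow> mem" where
  "norm_input n d A = input_mem n d ((\<lambda>_ _. 0)
    (0 := \<lambda>k. if k < n * d then A $$ (k div d, k mod d) else 0))"

text \<open>A time bound polynomial in \<open>n + d\<close> is the same as one polynomial in the number
  \<open>n * d\<close> of input reals, as \<open>n\<close> and \<open>d\<close> are positive.\<close>

definition poly_time_norm_approx ::
    "real \<Rightarrow> real \<Rightarrow> (nat \<Rightarrow> nat \<Rightarrow> real) \<Rightarrow> com \<Rightarrow> bool" where
  "poly_time_norm_approx q p \<theta> P \<longleftrightarrow>
    (\<exists>T :: nat poly. \<forall>n d A. n \<ge> 2 \<and> d \<ge> 1 \<and> A \<in> carrier_mat n d \<longrightarrow>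
      (\<exists>t s. exec P (norm_input n d A) t s \<and> t \<le> poly T (n + d) \<and>
        norm_approx q p (\<theta> n d) A (output_vec d s)))"


section \<open>The threshold correlation problem\<close>

definition unit_sphere :: "nat \<Rightarrow> real vec set" where
  "unit_sphere d = {x \<in> carrier_vec d. lp_norm 2 x = 1}"

definition tc_instance ::
    "nat \<Rightarrow> nat \<Rightarrow> (nat \<Rightarrow> real vec) \<Rightarrow> (nat \<Rightarrow> real) \<Rightarrow> real \<Rightarrow> bool" where
  "tc_instance n d v w \<tau> \<longleftrightarrow> n \<ge> 1 \<and> d \<ge> 1 \<and>
    (\<forall>i<n. v i \<in> carrier_vec d \<and> lp_norm 2 (v i) \<le> 1) \<and> (\<forall>i<n. w i \<ge> 0) \<and> \<tau> \<in> {0..1}"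

definition tc_value :: "nat \<Rightarrow> (nat \<Rightarrow> real vec) \<Rightarrow> (nat \<Rightarrow> real) \<Rightarrow> real \<Rightarrow> real vec \<Rightarrow> real" where
  "tc_value n v w \<tau> x = (\<Sum>i<n. of_bool ((x \<bullet> v i)\<^sup>2 \<ge> \<tau>) * w i * (x \<bullet> v i)\<^sup>2)"

text \<open>Again the supremum is attained for \<open>d \<ge> 1\<close>: the objective is upper semicontinuous on a compact
  set, because the threshold inequality is not strict.\<close>

definition tc_opt :: "nat \<Rightarrow> nat \<Rightarrow> (nat \<Rightarrow> real vec) \<Rightarrow> (nat \<Rightarrow> real) \<Rightarrow> real \<Rightarrow> real" where
  "tc_opt n d v w \<tau> = (SUP x \<in> unit_sphere d. tc_value n v w \<tau> x)"

definition tc_approx ::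
    "real \<Rightarrow> real \<Rightarrow> nat \<Rightarrow> nat \<Rightarrow> (nat \<Rightarrow> real vec) \<Rightarrow> (nat \<Rightarrow> real) \<Rightarrow> real \<Rightarrow> real vec \<Rightarrow> bool" where
  "tc_approx \<alpha> \<beta> n d v w \<tau> x \<longleftrightarrow>
    x \<in> unit_sphere d \<and> tc_value n v w (\<alpha> * \<tau>) x \<ge> \<beta> * tc_opt n d v w \<tau>"

text \<open>The threshold is part of the input, so one program handles all thresholds, within a time
  bound that does not depend on the threshold.\<close>

definition tc_input ::
    "nat \<Rightarrow> nat \<Rightarrow> (nat \<Rightarrow> real vec) \<Rightarrow> (nat \<Rightarrow> real) \<Rightarrow> real \<Rightarrow> mem" where
  "tc_input n d v w \<tau> = input_mem n d ((\<lambda>_ _. 0)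
    (0 := \<lambda>k. if k < n * d then v (k div d) $ (k mod d) else 0,
     1 := \<lambda>i. if i < n then w i else 0,
     2 := (\<lambda>_. 0)(0 := \<tau>)))"

definition poly_time_tc_approx ::
    "(nat \<Rightarrow> nat \<Rightarrow> real) \<Rightarrow> (nat \<Rightarrow> nat \<Rightarrow> real) \<Rightarrow> com \<Rightarrow> bool" where
  "poly_time_tc_approx \<alpha> \<beta> P \<longleftrightarrow>
    (\<exists>T :: nat poly. \<forall>n d v w \<tau>. tc_instance n d v w \<tau> \<longrightarrow>
      (\<exists>t s. exec P (tc_input n d v w \<tau>) t s \<and> t \<le> poly T (n + d) \<and>
        tc_approx (\<alpha> n d) (\<beta> n d) n d v w \<tau> (output_vec d s)))"

end

theory Submission
  imports Defs
begin

text \<open>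
  Scale the rows of \<open>A\<close> so that the longest one, \<open>v\<^sub>0\<close>, has norm 1, and let \<open>u\<close> be any unit vector.
  The dyadic level of an entry is the \<open>k\<close> with \<open>2 powr -(k + 1) < \<bar>\<langle>u, v\<^sub>i\<rangle>\<bar> powr p \<le> 2 powr -k\<close>.
  If \<open>\<Sum>\<^sub>i \<bar>\<langle>u, v\<^sub>i\<rangle>\<bar> powr p \<ge> 1\<close>, then one of the first \<open>O(log n)\<close> levels carries a \<open>1 / O(log n)\<close>
  fraction of this sum, and the TC algorithm with unit weights and threshold \<open>2 powr (-2(k+1)/p)\<close>
  finds a unit vector \<open>x\<close> whose power sum loses only a further factor \<open>\<alpha> powr (p/2 - 1) * \<beta>\<close>. If the
  sum is below 1, then \<open>v\<^sub>0\<close> itself is good enough.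

  The machine neither knows \<open>\<alpha>\<close>, \<open>\<beta>\<close> and the right level, nor can it compute \<open>p\<close>-th powers. So the
  program tries the thresholds of all levels \<open>k \<le> n\<close>, and \<open>v\<^sub>0\<close>, and keeps the candidate with the
  largest dyadic score \<open>\<Sum>\<^sub>i \<Sum>\<^sub>l 2 powr -l\<close>, where \<open>l\<close> ranges over the levels with
  \<open>r ^ l \<le> \<bar>\<langle>x, v\<^sub>i\<rangle>\<bar>\<close> and \<open>r = 2 powr (-1/p)\<close> is a constant of the program. Up to a constant factor
  and an additive \<open>1/2\<close> this score is the power sum, and the score of \<open>v\<^sub>0\<close> is at least 1.
\<close>


section \<open>Weakest preconditions with running time\<close>

text \<open>Total correctness: halting is part of the claim. As \<open>exec\<close> is
  deterministic, the existential speaks of the only run, whose step count is handed to the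
  postcondition.\<close>

definition wp :: "com \<Rightarrow> mem \<Rightarrow> (nat \<Rightarrow> mem \<Rightarrow> bool) \<Rightarrow> bool" where
  "wp c s Q \<longleftrightarrow> (\<exists>t s'. exec c s t s' \<and> Q t s')"

lemma wp_mono: "wp c s Q \<Longrightarrow> (\<And>t s'. Q t s' \<Longrightarrow> R t s') \<Longrightarrow> wp c s R"
  by (auto simp: wp_def)

lemma wp_Skip [simp]: "wp Skip s Q \<longleftrightarrow> Q 1 s"
  unfolding wp_def by (metis exec.Skip SkipE)

lemma wp_NSet [simp]: "wp (NSet a e f) s Q \<longleftrightarrow> Q 1 (nset a (nval e s) (nval f s) s)"
  unfolding wp_def by (metis exec.NSet NSetE)

lemma wp_RSet [simp]: "wp (RSet a e f) s Q \<longleftrightarrow> Q 1 (rset a (nval e s) (rval f s) s)"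
  unfolding wp_def by (metis exec.RSet RSetE)

lemma wp_NClear [simp]: "wp (NClear a) s Q \<longleftrightarrow> Q 1 (s\<lparr>nats := (nats s)(a := (\<lambda>_. 0))\<rparr>)"
  unfolding wp_def by (metis exec.NClear NClearE)

lemma wp_RClear [simp]: "wp (RClear a) s Q \<longleftrightarrow> Q 1 (s\<lparr>reals := (reals s)(a := (\<lambda>_. 0))\<rparr>)"
  unfolding wp_def by (metis exec.RClear RClearE)

text \<open>The steps already spent are added inside the postcondition, so simplification runs
  straight-line code symbolically and sums its cost at the same time.\<close>

lemma wp_Seq [simp]: "wp (Seq c d) s Q \<longleftrightarrow> wp c s (\<lambda>t s'. wp d s' (\<lambda>t'. Q (t + t')))"
proof -
  have "exec (Seq c d) s t s'' \<longleftrightarrow> (\<exists>t1 t2 s'. t = t1 + t2 \<and> exec c s t1 s' \<and> exec d s' t2 s'')" for t s''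
    by (auto intro: exec.Seq elim!: SeqE)
  then show ?thesis unfolding wp_def by simp blast
qed

lemma wp_If [simp]: "wp (If b c d) s Q \<longleftrightarrow>
    (if bval b s then wp c s (\<lambda>t. Q (t + 1)) else wp d s (\<lambda>t. Q (t + 1)))"
proof -
  have "exec (If b c d) s t s' \<longleftrightarrow> (\<exists>t'. t = t' + 1 \<and> exec (if bval b s then c else d) s t' s')" for t s'
    by (auto intro: exec.IfTrue[of b s, simplified] exec.IfFalse[of b s, simplified] elim!: IfE)
  then show ?thesis unfolding wp_def by auto
qed

lemma nats_nset [simp]: "nats (nset a i k s) b = (if b = a then (nats s a)(i := k) else nats s b)"
  and reals_nset [simp]: "reals (nset a i k s) = reals s"
  and nats_rset [simp]: "nats (rset a i x s) = nats s"
  and reals_rset [simp]: "reals (rset a i x s) b = (if b = a then (reals s a)(i := x) else reals s b)"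
  by (auto simp: nset_def rset_def)

section \<open>Frame conditions from the arrays a program can write\<close>

primrec nmods :: "com \<Rightarrow> nat set" where
  "nmods Skip = {}"
| "nmods (NSet a e f) = {a}"
| "nmods (RSet a e f) = {}"
| "nmods (NClear a) = {a}"
| "nmods (RClear a) = {}"
| "nmods (Seq c d) = nmods c \<union> nmods d"
| "nmods (If b c d) = nmods c \<union> nmods d"
| "nmods (While b c) = nmods c"

primrec rmods :: "com \<Rightarrow> nat set" where
  "rmods Skip = {}"
| "rmods (NSet a e f) = {}"
| "rmods (RSet a e f) = {a}"
| "rmods (NClear a) = {}"
| "rmods (RClear a) = {a}"
| "rmods (Seq c d) = rmods c \<union> rmods d"
| "rmods (If b c d) = rmods c \<union> rmods d"
| "rmods (While b c) = rmods c"

definition frame :: "nat set \<Rightarrow> nat set \<Rightarrow> mem \<Rightarrow> mem \<Rightarrow> bool" where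
  "frame X Y s s' \<longleftrightarrow> (\<forall>a. a \<notin> X \<longrightarrow> nats s' a = nats s a) \<and> (\<forall>a. a \<notin> Y \<longrightarrow> reals s' a = reals s a)"

lemma frame_nats: "frame X Y s s' \<Longrightarrow> a \<notin> X \<Longrightarrow> nats s' a = nats s a"
  by (auto simp: frame_def)

lemma exec_frame: "exec c s t s' \<Longrightarrow> frame (nmods c) (rmods c) s s'"
  by (induction rule: exec.induct) (auto simp: frame_def)

lemma wp_frame: "wp c s Q \<Longrightarrow> wp c s (\<lambda>t s'. Q t s' \<and> frame (nmods c) (rmods c) s s')"
  unfolding wp_def by (meson exec_frame)

text \<open>The specifications below mention only what a program computes; what it leaves alone is
  recovered from the frame at each use.\<close>

lemma wp_conseq:
  assumes "wp c s Q" "\<And>t s'. Q t s' \<Longrightarrow> frame (nmods c) (rmods c) s s' \<Longrightarrow> R t s'"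
  shows "wp c s R"
  using wp_frame[OF assms(1)] assms(2) by (rule wp_mono) auto

abbreviation nvar :: "nat \<Rightarrow> nexp" where "nvar a \<equiv> NCell a (NConst 0)"
abbreviation rvar :: "nat \<Rightarrow> rexp" where "rvar a \<equiv> RCell a (NConst 0)"
abbreviation nassign :: "nat \<Rightarrow> nexp \<Rightarrow> com" where "nassign a e \<equiv> NSet a (NConst 0) e"
abbreviation rassign :: "nat \<Rightarrow> rexp \<Rightarrow> com" where "rassign a e \<equiv> RSet a (NConst 0) e"
abbreviation incr :: "nat \<Rightarrow> com" where "incr a \<equiv> nassign a (NAdd (nvar a) (NConst 1))"

definition for_loop :: "nat \<Rightarrow> nat \<Rightarrow> com \<Rightarrow> com" where
  "for_loop a b c = Seq (nassign a (NConst 0)) (While (NLess (nvar a) (nvar b)) (Seq c (incr a)))"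

lemma nmods_for_loop [simp]: "nmods (for_loop a b c) = insert a (nmods c)"
  and rmods_for_loop [simp]: "rmods (for_loop a b c) = rmods c"
  by (auto simp: for_loop_def)

text \<open>Induction on the number of remaining rounds. The bound in \<open>b\<close> is constant
  because \<open>b\<close> is outside \<open>nmods c\<close>. A round costs \<open>T\<close> plus
  one increment and one test; the last 2 pays for the initialisation and the failing test. The
  invariant \<open>I k\<close> refers to the memory in which the counter is already
  \<open>k\<close>.\<close>

lemma wp_for_loop:
  fixes I :: "nat \<Rightarrow> mem \<Rightarrow> bool"
  assumes ab: "a \<notin> nmods c" "b \<notin> nmods c" "a \<noteq> b" and m: "nats s b 0 = m"
    and init: "I 0 (nset a 0 0 s)"
    and step: "\<And>k u. k < m \<Longrightarrow> I k u \<Longrightarrow> nats u a 0 = k \<Longrightarrow>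
      frame (insert a (nmods c)) (rmods c) s u \<Longrightarrow>
      wp c u (\<lambda>t u'. t \<le> T \<and> I (Suc k) (nset a 0 (Suc k) u'))"
  shows "wp (for_loop a b c) s (\<lambda>t s'. t \<le> m * (T + 2) + 2 \<and> I m s')"
proof -
  let ?B = "NLess (nvar a) (nvar b)" and ?c = "Seq c (incr a)"
  let ?F = "frame (insert a (nmods c)) (rmods c) s"
  have loop: "\<exists>t s'. exec (While ?B ?c) u t s' \<and> t \<le> (m - k) * (T + 2) + 1 \<and> I m s'"
    if "k \<le> m" "I k u" "nats u a 0 = k" "?F u" for k u
    using that
  proof (induction "m - k" arbitrary: k u)
    case 0
    then have k: "k = m" by simp
    have "nats u b 0 = m"
      using frame_nats[OF "0.prems"(4), of b] ab m by simp
    then have "\<not> bval ?B u" using "0.prems" k by simp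
    then have "exec (While ?B ?c) u 1 u" by (rule exec.WhileFalse)
    then show ?case using "0.prems" k by auto
  next
    case (Suc j)
    then have k: "k < m" by simp
    have ub: "nats u b 0 = m"
      using frame_nats[OF Suc.prems(4), of b] ab m by simp
    obtain t u' where u': "exec c u t u'" "t \<le> T" "I (Suc k) (nset a 0 (Suc k) u')"
      using step[OF k Suc.prems(2-4)] by (auto simp: wp_def)
    have fr: "frame (nmods c) (rmods c) u u'"
      using exec_frame[OF u'(1)] .
    have "nats u' a 0 = k"
      using frame_nats[OF fr, of a] ab Suc.prems(3) by simp
    then have "exec (incr a) u' 1 (nset a 0 (Suc k) u')"
      using exec.NSet[of a "NConst 0" "NAdd (nvar a) (NConst 1)" u'] by simp
    with u'(1) have body: "exec ?c u (t + 1) (nset a 0 (Suc k) u')"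
      by (rule exec.Seq)
    have "?F (nset a 0 (Suc k) u')"
      using Suc.prems(4) fr by (auto simp: frame_def)
    moreover have "j = m - Suc k" "Suc k \<le> m" "nats (nset a 0 (Suc k) u') a 0 = Suc k"
      using Suc.hyps(2) k by simp_all
    ultimately obtain t2 s' where s': "exec (While ?B ?c) (nset a 0 (Suc k) u') t2 s'"
        "t2 \<le> (m - Suc k) * (T + 2) + 1" "I m s'"
      using Suc.hyps(1)[of "Suc k" "nset a 0 (Suc k) u'"] u'(3) by blast
    have "bval ?B u" using ub k Suc.prems(3) by simp
    then have ex: "exec (While ?B ?c) u (t + 1 + t2 + 1) s'"
      using body s'(1) by (rule exec.WhileTrue)
    have "m - k = Suc (m - Suc k)" using k by simp
    then have "t + 1 + t2 + 1 \<le> (m - k) * (T + 2) + 1"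
      using u'(2) s'(2) by simp
    then show ?case using ex s'(3) by blast
  qed
  have "exec (nassign a (NConst 0)) s 1 (nset a 0 0 s)"
    using exec.NSet[of a "NConst 0" "NConst 0" s] by simp
  moreover obtain t s' where "exec (While ?B ?c) (nset a 0 0 s) t s'" "t \<le> m * (T + 2) + 1" "I m s'"
    using loop[of 0 "nset a 0 0 s"] init by (auto simp: frame_def)
  ultimately show ?thesis
    unfolding wp_def for_loop_def
    by (intro exI[of _ "1 + t"] exI[of _ s']) (simp add: exec.Seq del: One_nat_def)
qed

section \<open>A program depends only on the arrays it mentions\<close>

primrec nused :: "nexp \<Rightarrow> nat set" where
  "nused (NConst k) = {}"
| "nused (NCell a e) = insert a (nused e)"
| "nused (NAdd e f) = nused e \<union> nused f"
| "nused (NSub e f) = nused e \<union> nused f"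

primrec rused :: "rexp \<Rightarrow> nat set" where
  "rused (RConst r) = {}"
| "rused (RCell a e) = insert a (nused e)"
| "rused (ROfNat e) = nused e"
| "rused (RAdd e f) = rused e \<union> rused f"
| "rused (RSub e f) = rused e \<union> rused f"
| "rused (RMul e f) = rused e \<union> rused f"
| "rused (RDiv e f) = rused e \<union> rused f"
| "rused (RSqrt e) = rused e"

primrec bused :: "bexp \<Rightarrow> nat set" where
  "bused (NLess e f) = nused e \<union> nused f"
| "bused (RLess e f) = rused e \<union> rused f"
| "bused (BNot b) = bused b"
| "bused (BAnd b c) = bused b \<union> bused c"

text \<open>A name counts for the natural and the real array alike, so a single bound on names
  separates the data of two programs.\<close>

primrec used :: "com \<Rightarrow> nat set" where
  "used Skip = {}"
| "used (NSet a e f) = insert a (nused e \<union> nused f)"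
| "used (RSet a e f) = insert a (nused e \<union> rused f)"
| "used (NClear a) = {a}"
| "used (RClear a) = {a}"
| "used (Seq c d) = used c \<union> used d"
| "used (If b c d) = bused b \<union> used c \<union> used d"
| "used (While b c) = bused b \<union> used c"

lemma finite_nused: "finite (nused e)" by (induction e) auto
lemma finite_rused: "finite (rused e)" by (induction e) (auto simp: finite_nused)
lemma finite_bused: "finite (bused e)" by (induction e) (auto simp: finite_nused finite_rused)
lemma finite_used: "finite (used c)"
  by (induction c) (auto simp: finite_nused finite_rused finite_bused)

lemma nmods_subset_used: "nmods c \<subseteq> used c" by (induction c) auto
lemma rmods_subset_used: "rmods c \<subseteq> used c" by (induction c) auto

abbreviation agree :: "nat set \<Rightarrow> mem \<Rightarrow> mem \<Rightarrow> bool" where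
  "agree U \<equiv> frame (- U) (- U)"

lemma nval_agree: "agree U s s' \<Longrightarrow> nused e \<subseteq> U \<Longrightarrow> nval e s' = nval e s"
  by (induction e) (auto simp: frame_def)

lemma rval_agree: "agree U s s' \<Longrightarrow> rused e \<subseteq> U \<Longrightarrow> rval e s' = rval e s"
  by (induction e) (auto simp: frame_def nval_agree)

lemma bval_agree: "agree U s s' \<Longrightarrow> bused b \<subseteq> U \<Longrightarrow> bval b s' = bval b s"
  by (induction b) (auto simp: nval_agree rval_agree)

text \<open>A simulation: the arrays in \<open>U\<close> determine all values and tests, so both
  runs take the same branches and equally many steps. A program specified on one particular initial
  memory can thus be run beside foreign data.\<close>

lemma exec_agree:
  "exec c s t s' \<Longrightarrow> agree U s u \<Longrightarrow> used c \<subseteq> U \<Longrightarrow> \<exists>u'. exec c u t u' \<and> agree U s' u'"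
proof (induction arbitrary: u rule: exec.induct)
  case (Skip s)
  then show ?case using exec.Skip by blast
next
  case (NSet a e f s)
  then have "agree U (nset a (nval e s) (nval f s) s) (nset a (nval e u) (nval f u) u)"
    by (auto simp: frame_def nval_agree[of U s u])
  then show ?case by (blast intro: exec.NSet)
next
  case (RSet a e f s)
  then have "agree U (rset a (nval e s) (rval f s) s) (rset a (nval e u) (rval f u) u)"
    by (auto simp: frame_def nval_agree[of U s u] rval_agree[of U s u])
  then show ?case by (blast intro: exec.RSet)
next
  case (NClear a s)
  then have "agree U (s\<lparr>nats := (nats s)(a := (\<lambda>_. 0))\<rparr>) (u\<lparr>nats := (nats u)(a := (\<lambda>_. 0))\<rparr>)"
    by (auto simp: frame_def)
  then show ?case by (blast intro: exec.NClear)
next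
  case (RClear a s)
  then have "agree U (s\<lparr>reals := (reals s)(a := (\<lambda>_. 0))\<rparr>) (u\<lparr>reals := (reals u)(a := (\<lambda>_. 0))\<rparr>)"
    by (auto simp: frame_def)
  then show ?case by (blast intro: exec.RClear)
next
  case (Seq c s t s' d t' s'')
  then have "used c \<subseteq> U" "used d \<subseteq> U" by auto
  with Seq show ?case by (meson exec.Seq)
next
  case (IfTrue b s c t s' d)
  then have "used c \<subseteq> U" "bval b u" by (auto simp: bval_agree[of U s u])
  with IfTrue show ?case by (meson exec.IfTrue)
next
  case (IfFalse b s d t s' c)
  then have "used d \<subseteq> U" "\<not> bval b u" by (auto simp: bval_agree[of U s u])
  with IfFalse show ?case by (meson exec.IfFalse)
next
  case (WhileFalse b s c)
  then have "\<not> bval b u" by (auto simp: bval_agree[of U s u])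
  with WhileFalse show ?case by (meson exec.WhileFalse)
next
  case (WhileTrue b s c t s' t' s'')
  then have "used c \<subseteq> U" "bval b u" by (auto simp: bval_agree[of U s u])
  with WhileTrue show ?case by (meson exec.WhileTrue)
qed

section \<open>Dyadic scores and the threshold correlation bound\<close>

text \<open>With \<open>r = level_base p\<close> the test means
  \<open>(1/2) ^ l \<le> y powr p\<close>. The sum is then a truncated geometric series comparable
  to \<open>y powr p\<close>, evaluated by products and comparisons only.\<close>

definition level_score :: "real \<Rightarrow> nat \<Rightarrow> real \<Rightarrow> real" where
  "level_score r K y = (\<Sum>l<K. if r ^ l \<le> y then (1/2) ^ l else 0)"

definition vec_score :: "real \<Rightarrow> nat \<Rightarrow> nat \<Rightarrow> (nat \<Rightarrow> real vec) \<Rightarrow> real vec \<Rightarrow> real" where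
  "vec_score r K n v x = (\<Sum>i<n. level_score r K \<bar>x \<bullet> v i\<bar>)"

lemma level_score_nonneg: "0 \<le> level_score r K y"
  by (auto simp: level_score_def intro!: sum_nonneg)

lemma vec_score_nonneg: "0 \<le> vec_score r K n v x"
  by (simp add: vec_score_def level_score_nonneg sum_nonneg)

section \<open>Norms and inner products\<close>

lemma lp_norm_2: "lp_norm 2 x = sqrt (\<Sum>i<dim_vec x. (x $ i)\<^sup>2)"
proof -
  have "\<bar>a\<bar> powr 2 = a\<^sup>2" for a :: real
    by (cases "a = 0") (simp_all add: powr_numeral)
  then show ?thesis by (simp add: lp_norm_def powr_half_sqrt sum_nonneg)
qed

lemma lp_norm_smult:
  assumes "p > 0"
  shows "lp_norm p (c \<cdot>\<^sub>v x) = \<bar>c\<bar> * lp_norm p x"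
proof -
  have "(\<Sum>i<dim_vec x. \<bar>c * x $ i\<bar> powr p) = \<bar>c\<bar> powr p * (\<Sum>i<dim_vec x. \<bar>x $ i\<bar> powr p)"
    by (simp add: sum_distrib_left abs_mult powr_mult)
  then show ?thesis
    using assms by (simp add: lp_norm_def powr_mult sum_nonneg powr_powr)
qed

lemma lp_norm_2_pos:
  assumes "x \<in> carrier_vec d" "x \<noteq> 0\<^sub>v d"
  shows "lp_norm 2 x > 0"
proof -
  obtain i where "i < d" "x $ i \<noteq> 0" using assms by (metis carrier_vecD eq_vecI index_zero_vec)
  then have "0 < (\<Sum>i<d. (x $ i)\<^sup>2)" by (intro sum_pos2[of _ i]) auto
  then show ?thesis using assms(1) by (auto simp: lp_norm_2)
qed

text \<open>Cauchy-Schwarz on the unit ball, obtained termwise from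
  \<open>2 * \<bar>a * b\<bar> \<le> a\<^sup>2 + b\<^sup>2\<close>.\<close>

lemma abs_scalar_prod_le_1:
  assumes "x \<in> carrier_vec d" "v \<in> carrier_vec d" "lp_norm 2 x \<le> 1" "lp_norm 2 v \<le> 1"
  shows "\<bar>x \<bullet> v\<bar> \<le> 1"
proof -
  have "(\<Sum>i<d. (x $ i)\<^sup>2) \<le> 1" "(\<Sum>i<d. (v $ i)\<^sup>2) \<le> 1"
    using assms by (simp_all add: lp_norm_2)
  have "\<bar>x \<bullet> v\<bar> \<le> (\<Sum>i<d. \<bar>x $ i * v $ i\<bar>)"
    using assms(2) by (simp add: scalar_prod_def atLeast0LessThan)
  also have "\<dots> \<le> (\<Sum>i<d. ((x $ i)\<^sup>2 + (v $ i)\<^sup>2) / 2)"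
  proof (rule sum_mono)
    fix i
    have "0 \<le> (\<bar>x $ i\<bar> - \<bar>v $ i\<bar>)\<^sup>2" by simp
    then show "\<bar>x $ i * v $ i\<bar> \<le> ((x $ i)\<^sup>2 + (v $ i)\<^sup>2) / 2"
      by (simp add: power2_diff abs_mult)
  qed
  also have "\<dots> \<le> 1"
    using \<open>(\<Sum>i<d. (x $ i)\<^sup>2) \<le> 1\<close> \<open>(\<Sum>i<d. (v $ i)\<^sup>2) \<le> 1\<close>
    by (simp add: sum.distrib flip: sum_divide_distrib)
  finally show ?thesis .
qed

section \<open>Dyadic levels of \<open>p\<close>-th powers\<close>

definition level_base :: "real \<Rightarrow> real" where
  "level_base p = 2 powr (- 1 / p)"

lemma level_base_pos: "level_base p > 0"
  by (simp add: level_base_def)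

lemma level_base_powr:
  assumes "p > 0"
  shows "(level_base p ^ l) powr p = (1/2) ^ l"
proof -
  have "level_base p ^ l = 2 powr (real l * (- 1 / p))"
    by (simp add: level_base_def powr_power)
  then have "(level_base p ^ l) powr p = 2 powr (- real l)"
    using assms by (simp add: powr_powr)
  then show ?thesis by (simp add: powr_minus powr_realpow power_divide inverse_eq_divide)
qed

text \<open>The map \<open>y powr p\<close> is strictly increasing on \<open>y \<ge> 0\<close> and
  sends \<open>level_base p ^ l\<close> to \<open>(1/2) ^ l\<close>. A test the machine can perform
  thus becomes a dyadic test on the power.\<close>

lemma level_base_le_iff:
  assumes "p > 0" "y \<ge> 0"
  shows "level_base p ^ l \<le> y \<longleftrightarrow> (1/2) ^ l \<le> y powr p"
proof -
  have pos: "0 \<le> level_base p ^ l" by (simp add: level_base_pos less_imp_le)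
  show ?thesis
    using powr_mono2[of p "level_base p ^ l" y] powr_less_mono2[of p y "level_base p ^ l"] assms pos
    by (force simp: level_base_powr not_le[symmetric])
qed

text \<open>The counted levels start at the first one with \<open>(1/2) ^ l \<le> y powr p\<close>,
  and a geometric series of ratio 1/2 stays below twice its first term.\<close>

lemma level_score_le:
  assumes "p > 0" "y \<ge> 0"
  shows "level_score (level_base p) K y \<le> 2 * y powr p"
proof -
  define z where "z = y powr p"
  \<comment> \<open>Strengthened for the induction: the series falls short of \<open>2 * z\<close>
    by at least its last term. If level \<open>k\<close> is not reached, no earlier one is, and the
    sum is 0.\<close>
  have "(\<Sum>l<Suc k. if (1/2) ^ l \<le> z then (1/2) ^ l else 0) \<le>
      (if (1/2) ^ k \<le> z then 2 * z - (1/2) ^ k else 0)" for k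
    by (induction k) auto
  then have "(\<Sum>l<Suc k. if (1/2) ^ l \<le> z then (1/2) ^ l else 0) \<le> 2 * z" for k
    by (rule order.trans) (auto simp: z_def)
  then show ?thesis
    using assms by (cases K) (auto simp: level_score_def level_base_le_iff z_def)
qed

text \<open>The first level reached is within a factor 2 of \<open>y powr p\<close>; if none up to
  \<open>n\<close> is reached, then \<open>y powr p < (1/2) ^ n\<close>.\<close>

lemma powr_le_level_score:
  assumes "p > 0" "y \<ge> 0" "y \<le> 1"
  shows "y powr p \<le> 2 * level_score (level_base p) (Suc n) y + (1/2) ^ n"
proof -
  define z where "z = y powr p"
  have z1: "z \<le> 1" unfolding z_def using powr_mono2[of p y 1] assms by simp
  have nn: "0 \<le> (\<Sum>l<k. if (1/2) ^ l \<le> z then (1/2) ^ l else 0 :: real)" for k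
    by (intro sum_nonneg) auto
  have "z \<le> 2 * (\<Sum>l<Suc n. if (1/2) ^ l \<le> z then (1/2) ^ l else 0) + (1/2) ^ n"
  proof (induction n)
    case (Suc n)
    have pos: "0 \<le> (1/2 :: real) ^ Suc n" by simp
    show ?case
    proof (cases "(1/2) ^ Suc n \<le> z")
      \<comment> \<open>The new term, counted twice, makes up for the old error
        \<open>(1/2) ^ n\<close>.\<close>
      case True
      show ?thesis
        unfolding sum.lessThan_Suc[of _ "Suc n"] if_P[OF True] distrib_left
        using Suc.IH pos power_Suc[of "1/2 :: real" n] by linarith
    qed (use nn[of "Suc n"] in auto)
  qed (use z1 in auto)
  then show ?thesis using assms by (simp only: level_score_def level_base_le_iff z_def)
qed

lemma level_score_one: "p > 0 \<Longrightarrow> 1 \<le> level_score (level_base p) (Suc n) 1"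
proof -
  assume "p > 0"
  then have "(if level_base p ^ 0 \<le> 1 then (1/2) ^ 0 else 0) \<le> level_score (level_base p) (Suc n) 1"
    unfolding level_score_def by (intro member_le_sum) auto
  then show ?thesis by simp
qed

definition power_sum :: "real \<Rightarrow> nat \<Rightarrow> (nat \<Rightarrow> real vec) \<Rightarrow> real vec \<Rightarrow> real" where
  "power_sum p n v x = (\<Sum>i<n. \<bar>x \<bullet> v i\<bar> powr p)"

lemma power_sum_nonneg: "0 \<le> power_sum p n v x"
  by (simp add: power_sum_def sum_nonneg)

lemma vec_score_le: "p > 0 \<Longrightarrow> vec_score (level_base p) K n v x \<le> 2 * power_sum p n v x"
  unfolding vec_score_def power_sum_def sum_distrib_left
  by (intro sum_mono level_score_le) auto

lemma two_mult_le_power: "2 \<le> n \<Longrightarrow> 2 * n \<le> 2 ^ n" for n :: nat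
  by (induction n rule: dec_induct) auto

text \<open>The \<open>n\<close> truncation errors \<open>(1/2) ^ n\<close> total at most 1/2,
  because \<open>2 * n \<le> 2 ^ n\<close>. This is why \<open>n + 1\<close> levels suffice.\<close>

lemma power_sum_le:
  assumes "p > 0" "n \<ge> 2" "\<And>i. i < n \<Longrightarrow> \<bar>x \<bullet> v i\<bar> \<le> 1"
  shows "power_sum p n v x \<le> 2 * vec_score (level_base p) (Suc n) n v x + 1/2"
proof -
  have "power_sum p n v x \<le> (\<Sum>i<n. 2 * level_score (level_base p) (Suc n) \<bar>x \<bullet> v i\<bar> + (1/2) ^ n)"
    unfolding power_sum_def using assms by (intro sum_mono powr_le_level_score) auto
  also have "\<dots> = 2 * vec_score (level_base p) (Suc n) n v x + n * (1/2) ^ n"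
    by (simp add: sum.distrib vec_score_def sum_distrib_left)
  also have "real n * (1/2) ^ n \<le> 1/2"
  proof -
    have "real (2 * n) \<le> real (2 ^ n)" using two_mult_le_power[OF assms(2)] by (rule of_nat_mono)
    then show ?thesis by (simp add: field_simps)
  qed
  finally show ?thesis by simp
qed

text \<open>The index \<open>k\<close> ranges over \<open>L \<approx> log\<^sub>2 (2 * n)\<close> dyadic levels: entries below \<open>1 / (2 * n)\<close>
  contribute at most half of the sum, so one level carries a \<open>1 / (2 * L)\<close> fraction of it.\<close>

lemma heavy_level:
  fixes z :: "nat \<Rightarrow> real"
  assumes n: "n \<ge> 2" and z: "\<And>i. i < n \<Longrightarrow> 0 \<le> z i \<and> z i \<le> 1" and W: "(\<Sum>i<n. z i) \<ge> 1"
  shows "\<exists>k<Suc n. (\<Sum>i<n. z i) * ln 2 / (12 * ln n) \<le> card {i \<in> {..<n}. (1/2) ^ Suc k \<le> z i} * (1/2) ^ Suc k"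
proof -
  define L where "L = nat \<lceil>log 2 (2 * n)\<rceil>"
  define T where "T k = {i \<in> {..<n}. (1/2) ^ Suc k \<le> z i}" for k
  let ?W = "\<Sum>i<n. z i"
  have log: "log 2 (2 * n) = 1 + log 2 n" "log 2 n \<ge> 1" using n by (simp_all add: log_mult)
  have "log 2 (2 * n) \<le> L" unfolding L_def by linarith
  then have "2 powr log 2 (2 * n) \<le> 2 powr L" by simp
  then have L2: "2 * real n \<le> 2 ^ L" using n by (simp add: powr_realpow)
  have "real (2 * n) \<le> real (2 ^ n)" using two_mult_le_power[OF n] by (rule of_nat_mono)
  then have "log 2 (2 * n) \<le> log 2 (2 ^ n)" using n by (intro log_mono) auto
  \<comment> \<open>All \<open>L\<close> levels are thereby among those that the program
    tries.\<close>
  then have Ln: "L < Suc n" unfolding L_def by (simp add: log_nat_power) linarith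
  have L0: "L > 0" unfolding L_def using log by linarith
  \<comment> \<open>Rounding up gives \<open>L \<le> 2 + log 2 n\<close>, and
    \<open>log 2 n \<ge> 1\<close> absorbs the 2.\<close>
  have "L \<le> 3 * log 2 n" unfolding L_def using log by linarith
  then have Lln: "L * ln 2 \<le> 3 * ln n" using n by (simp add: log_def field_simps)
  \<comment> \<open>The upper end of the dyadic level containing \<open>y\<close> is a summand and
    is at least \<open>y\<close>, unless \<open>y\<close> lies below all \<open>m\<close> levels,
    where \<open>(1/2) ^ m\<close> takes over.\<close>
  have layer: "y \<le> (1/2) ^ m + (\<Sum>k<m. if (1/2) ^ Suc k \<le> y then (1/2) ^ k else 0)" if "0 \<le> y" "y \<le> 1" for y :: real and m
  proof (induction m)
    case (Suc m)
    have nn: "0 \<le> (\<Sum>k<m. if (1/2) ^ Suc k \<le> y then (1/2) ^ k else 0 :: real)" "0 \<le> (1/2 :: real) ^ Suc m"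
      by (auto intro!: sum_nonneg)
    show ?case
    proof (cases "(1/2) ^ Suc m \<le> y")
      case True
      then show ?thesis
        unfolding sum.lessThan_Suc if_P[OF True] using Suc.IH nn(2) by linarith
    qed (use nn in auto)
  qed (use that in auto)
  have "?W \<le> (\<Sum>i<n. (1/2) ^ L + (\<Sum>k<L. if (1/2) ^ Suc k \<le> z i then (1/2) ^ k else 0))"
    using z by (intro sum_mono layer) auto
  also have "\<dots> = n * (1/2) ^ L + (\<Sum>k<L. \<Sum>i<n. if (1/2) ^ Suc k \<le> z i then (1/2) ^ k else 0)"
    by (simp add: sum.distrib sum.swap[of _ "{..<n}"])
  also have "(\<Sum>k<L. \<Sum>i<n. if (1/2) ^ Suc k \<le> z i then (1/2) ^ k else 0) =
      2 * (\<Sum>k<L. card (T k) * (1/2) ^ Suc k)"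
    unfolding sum_distrib_left
  proof (rule sum.cong)
    fix k
    have "(\<Sum>i<n. if (1/2) ^ Suc k \<le> z i then (1/2) ^ k else 0) = (\<Sum>i\<in>T k. (1/2) ^ k :: real)"
      unfolding T_def by (rule sum.inter_filter[symmetric]) simp
    then show "(\<Sum>i<n. if (1/2) ^ Suc k \<le> z i then (1/2) ^ k else 0) = 2 * (card (T k) * (1/2) ^ Suc k)"
      by simp
  qed simp
  also have "n * (1/2) ^ L \<le> (1/2 :: real)" using L2 by (simp add: field_simps)
  finally have main: "?W \<le> 1/2 + 2 * (\<Sum>k<L. card (T k) * (1/2) ^ Suc k)" by simp
  \<comment> \<open>Averaging: if all \<open>L\<close> levels were lighter, the sum in
    \<open>main\<close> would be below \<open>?W / 4\<close>, so \<open>?W < 1/2 + ?W / 2\<close>,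
    contradicting \<open>?W \<ge> 1\<close>.\<close>
  have "\<exists>k<L. ?W / (4 * L) \<le> card (T k) * (1/2) ^ Suc k"
  proof (rule ccontr)
    assume "\<not> ?thesis"
    then have "(\<Sum>k<L. card (T k) * (1/2) ^ Suc k) < (\<Sum>k<L. ?W / (4 * L))"
      using L0 by (intro sum_strict_mono) auto
    then show False using main W L0 by simp
  qed
  then obtain k where k: "k < L" "?W / (4 * L) \<le> card (T k) * (1/2) ^ Suc k" by blast
  have "?W * ln 2 / (12 * ln n) \<le> ?W / (4 * L)"
  proof -
    have "?W * (L * ln 2) \<le> ?W * (3 * ln n)" using W Lln by (intro mult_left_mono) auto
    then show ?thesis using n L0 by (simp add: field_simps)
  qed
  then show ?thesis using k Ln by (intro exI[of _ k]) (auto simp: T_def)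
qed

section \<open>From threshold correlation to power sums\<close>

lemma tc_value_le_tc_opt:
  assumes "tc_instance n d v w \<tau>" "x \<in> unit_sphere d"
  shows "tc_value n v w \<tau> x \<le> tc_opt n d v w \<tau>"
  unfolding tc_opt_def
proof (rule cSUP_upper[OF assms(2)])
  \<comment> \<open>A real supremum bounds its set only if that set is bounded above. All
    correlations are at most 1, so the total weight is a bound.\<close>
  show "bdd_above (tc_value n v w \<tau> ` unit_sphere d)"
  proof (rule bdd_aboveI2)
    fix y assume y: "y \<in> unit_sphere d"
    show "tc_value n v w \<tau> y \<le> (\<Sum>i<n. w i)"
      unfolding tc_value_def
    proof (rule sum_mono)
      fix i assume "i \<in> {..<n}"
      then have "\<bar>y \<bullet> v i\<bar> \<le> 1" "w i \<ge> 0"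
        using assms(1) y by (auto simp: tc_instance_def unit_sphere_def intro!: abs_scalar_prod_le_1)
      then have "w i * (y \<bullet> v i)\<^sup>2 \<le> w i * 1" by (intro mult_left_mono) (auto simp: abs_square_le_1)
      then show "of_bool (\<tau> \<le> (y \<bullet> v i)\<^sup>2) * w i * (y \<bullet> v i)\<^sup>2 \<le> w i"
        using \<open>w i \<ge> 0\<close> by (simp add: of_bool_def)
    qed
  qed
qed

text \<open>A counted entry has \<open>\<tau> \<le> y\<^sup>2\<close>. Since \<open>p > 2\<close>
  makes the exponent positive, the factor \<open>(y\<^sup>2) powr (p/2 - 1)\<close> of
  \<open>y powr p\<close> is at least \<open>\<tau> powr (p/2 - 1)\<close>.\<close>

lemma power_sum_ge_tc_value:
  assumes "p > 2" "\<tau> \<ge> 0"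
  shows "\<tau> powr (p/2 - 1) * tc_value n v (\<lambda>_. 1) \<tau> x \<le> power_sum p n v x"
  unfolding tc_value_def power_sum_def sum_distrib_left
proof (rule sum_mono)
  fix i
  let ?y = "\<bar>x \<bullet> v i\<bar>"
  have "\<tau> powr (p/2 - 1) * ?y\<^sup>2 \<le> ?y powr p" if "\<tau> \<le> ?y\<^sup>2"
  proof (cases "?y = 0")
    case False
    then have sq: "?y\<^sup>2 = ?y powr 2" by (simp add: powr_numeral)
    have "\<tau> powr (p/2 - 1) * ?y\<^sup>2 \<le> (?y\<^sup>2) powr (p/2 - 1) * ?y\<^sup>2"
      using assms that by (intro mult_right_mono powr_mono2) auto
    also have "\<dots> = ?y powr (2 * (p/2 - 1) + 2)"
      unfolding sq powr_powr powr_add ..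
    also have "2 * (p/2 - 1) + 2 = p" by simp
    finally show ?thesis .
  qed simp
  then show "\<tau> powr (p/2 - 1) * (of_bool (\<tau> \<le> (x \<bullet> v i)\<^sup>2) * 1 * (x \<bullet> v i)\<^sup>2) \<le> ?y powr p"
    by (simp add: of_bool_def)
qed

text \<open>The threshold is the square of the cutoff \<open>level_base p ^ Suc k\<close>, so
  \<open>u\<close> has TC value at least the cardinality times the threshold. The approximation
  keeps a fraction \<open>\<beta>\<close> of it at threshold \<open>\<alpha> * \<tau>\<close>, and
  the previous lemma turns this into \<open>p\<close>-th powers.\<close>

lemma power_sum_ge_level:
  assumes p: "p > 2" and \<alpha>: "\<alpha> > 0" and \<beta>: "\<beta> \<ge> 0"
    and inst: "tc_instance n d v (\<lambda>_. 1) (level_base p ^ (2 * k + 2))"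
    and u: "u \<in> unit_sphere d"
    and x: "tc_approx \<alpha> \<beta> n d v (\<lambda>_. 1) (level_base p ^ (2 * k + 2)) x"
  shows "\<alpha> powr (p/2 - 1) * \<beta> * (card {i \<in> {..<n}. (1/2) ^ Suc k \<le> \<bar>u \<bullet> v i\<bar> powr p} * (1/2) ^ Suc k)
    \<le> power_sum p n v x"
proof -
  define \<tau> where "\<tau> = level_base p ^ (2 * k + 2)"
  define T where "T = {i \<in> {..<n}. (1/2) ^ Suc k \<le> \<bar>u \<bullet> v i\<bar> powr p}"
  have \<tau>0: "\<tau> > 0" by (simp add: \<tau>_def level_base_pos)
  have \<tau>sq: "\<tau> = (level_base p ^ Suc k)\<^sup>2" by (simp add: \<tau>_def power2_eq_square power_add mult_2)
  have "\<tau> powr (p/2) = (level_base p ^ Suc k) powr p"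
  proof -
    have "\<tau> = (level_base p ^ Suc k) powr 2"
      unfolding \<tau>sq using zero_less_power[OF level_base_pos, of p "Suc k"] by (simp add: powr_numeral del: power_Suc)
    then show ?thesis by (simp add: powr_powr)
  qed
  \<comment> \<open>The powers of \<open>\<tau>\<close> recombine to the level weight, which leaves
    a loss in \<open>\<alpha>\<close> and \<open>\<beta>\<close> only.\<close>
  then have \<tau>p: "\<tau> powr (p/2 - 1) * \<tau> = (1/2) ^ Suc k"
    using p \<tau>0 by (simp add: level_base_powr powr_diff del: power_Suc)
  have "card T * \<tau> = (\<Sum>i\<in>T. \<tau>)" by simp
  also have "\<dots> \<le> (\<Sum>i\<in>T. of_bool (\<tau> \<le> (u \<bullet> v i)\<^sup>2) * 1 * (u \<bullet> v i)\<^sup>2)"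
  proof (rule sum_mono)
    fix i assume "i \<in> T"
    then have "level_base p ^ Suc k \<le> \<bar>u \<bullet> v i\<bar>"
      using p level_base_le_iff[of p "\<bar>u \<bullet> v i\<bar>" "Suc k"] by (simp add: T_def)
    then have "\<tau> \<le> \<bar>u \<bullet> v i\<bar>\<^sup>2"
      unfolding \<tau>sq by (intro power_mono) (simp_all add: level_base_pos less_imp_le)
    then show "\<tau> \<le> of_bool (\<tau> \<le> (u \<bullet> v i)\<^sup>2) * 1 * (u \<bullet> v i)\<^sup>2" by simp
  qed
  also have "\<dots> \<le> tc_value n v (\<lambda>_. 1) \<tau> u"
    unfolding tc_value_def by (rule sum_mono2) (auto simp: T_def)
  also have "\<dots> \<le> tc_opt n d v (\<lambda>_. 1) \<tau>"
    using inst u by (auto intro: tc_value_le_tc_opt simp: \<tau>_def)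
  finally have "\<beta> * (card T * \<tau>) \<le> \<beta> * tc_opt n d v (\<lambda>_. 1) \<tau>"
    using \<beta> by (rule mult_left_mono)
  also have "\<dots> \<le> tc_value n v (\<lambda>_. 1) (\<alpha> * \<tau>) x"
    using x by (simp add: tc_approx_def \<tau>_def)
  finally have "(\<alpha> * \<tau>) powr (p/2 - 1) * (\<beta> * (card T * \<tau>)) \<le>
      (\<alpha> * \<tau>) powr (p/2 - 1) * tc_value n v (\<lambda>_. 1) (\<alpha> * \<tau>) x"
    by (rule mult_left_mono) simp
  also have "\<dots> \<le> power_sum p n v x"
    using p \<alpha> \<tau>0 by (intro power_sum_ge_tc_value) auto
  also have "(\<alpha> * \<tau>) powr (p/2 - 1) * (\<beta> * (card T * \<tau>)) =
      \<alpha> powr (p/2 - 1) * \<beta> * (card T * (\<tau> powr (p/2 - 1) * \<tau>))"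
    using \<alpha> \<tau>0 by (simp add: powr_mult)
  finally show ?thesis unfolding \<tau>p T_def .
qed

text \<open>A heavy level of \<open>u\<close> has its own candidate \<open>y\<close>, and
  \<open>x\<close> scores at least as well. The constant is 144 = 12 * 2 * 6: 12 from
  \<open>heavy_level\<close>, 2 from \<open>ln 2 \<ge> 1/2\<close>, and 6 from comparing scores with
  power sums.\<close>

lemma power_sum_best_candidate:
  assumes p: "p > 2" and n: "n \<ge> 2" and \<alpha>: "\<alpha> \<in> {0<..1}" and \<beta>: "\<beta> \<in> {0<..1}"
    and inst: "\<And>k. tc_instance n d v (\<lambda>_. 1) (level_base p ^ (2 * k + 2))"
    and F: "F = vec_score (level_base p) (n + 1) n v"
    and F1: "1 \<le> F x"
    and best: "\<And>k. k < n + 1 \<Longrightarrow>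
      \<exists>y. tc_approx \<alpha> \<beta> n d v (\<lambda>_. 1) (level_base p ^ (2 * k + 2)) y \<and> F y \<le> F x"
    and u: "u \<in> unit_sphere d"
  shows "1/144 * (\<alpha> powr (p/2 - 1) * \<beta> / ln n) * power_sum p n v u \<le> power_sum p n v x"
proof -
  let ?W = "power_sum p n v u" and ?a = "\<alpha> powr (p/2 - 1) * \<beta>"
  have ln2: "ln 2 \<ge> (1/2 :: real)"
    using ln_le_minus_one[of "1/2 :: real"] by (simp add: ln_div)
  have lnn: "ln n \<ge> ln 2" using n by simp
  have dot: "\<bar>y \<bullet> v i\<bar> \<le> 1" if "y \<in> unit_sphere d" "i < n" for y i
    using that inst[of 0] by (auto simp: tc_instance_def unit_sphere_def intro!: abs_scalar_prod_le_1)
  have Fx: "F x \<le> 2 * power_sum p n v x"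
    unfolding F using p by (intro vec_score_le) auto
  have a0: "?a \<ge> 0" using \<beta> by simp
  show ?thesis
  proof (cases "?W < 1")
    \<comment> \<open>Here \<open>1 \<le> F x\<close> alone gives \<open>x\<close> a power sum of at
      least 1/2, while the left-hand side is at most 2/144.\<close>
    case True
    have "\<alpha> powr (p/2 - 1) \<le> 1" using powr_mono2[of "p/2 - 1" \<alpha> 1] \<alpha> p by simp
    then have "?a \<le> 1" using \<beta> by (intro mult_le_one) auto
    then have "?a * ?W \<le> 1"
      using True power_sum_nonneg[of p n v u] mult_le_one[of ?a ?W] by simp
    define c where "c = ?a * ?W / ln n"
    have c: "c \<le> 1 / (1/2)"
      unfolding c_def using \<open>?a * ?W \<le> 1\<close> ln2 lnn a0 power_sum_nonneg[of p n v u] by (intro frac_le) auto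
    have "1/144 * (?a / ln n) * ?W = 1/144 * c" by (simp add: c_def)
    also have "\<dots> \<le> power_sum p n v x" using c Fx F1 by simp
    finally show ?thesis .
  next
    case False
    have "\<exists>k<Suc n. ?W * ln 2 / (12 * ln n) \<le>
        card {i \<in> {..<n}. (1/2) ^ Suc k \<le> \<bar>u \<bullet> v i\<bar> powr p} * (1/2) ^ Suc k"
      unfolding power_sum_def
    proof (rule heavy_level[OF n])
      fix i assume "i < n"
      then show "0 \<le> \<bar>u \<bullet> v i\<bar> powr p \<and> \<bar>u \<bullet> v i\<bar> powr p \<le> 1"
        using powr_mono2[of p "\<bar>u \<bullet> v i\<bar>" 1] dot[OF u] p by simp
    qed (use False in \<open>simp add: power_sum_def\<close>)
    then obtain k where k: "k < Suc n" "?W * ln 2 / (12 * ln n) \<le>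
        card {i \<in> {..<n}. (1/2) ^ Suc k \<le> \<bar>u \<bullet> v i\<bar> powr p} * (1/2) ^ Suc k" by blast
    obtain y where y: "tc_approx \<alpha> \<beta> n d v (\<lambda>_. 1) (level_base p ^ (2 * k + 2)) y" "F y \<le> F x"
      using best[of k] k by auto
    have "?a * (?W * ln 2 / (12 * ln n)) \<le> power_sum p n v y"
      using mult_left_mono[OF k(2) a0] power_sum_ge_level[OF p _ _ inst u y(1)] \<alpha> \<beta> by (simp del: power_Suc)
    also have "power_sum p n v y \<le> 2 * F y + 1/2"
      unfolding F using p n dot y(1) by (simp add: tc_approx_def) (intro power_sum_le, auto)
    \<comment> \<open>The additive 1/2 is absorbed because \<open>1 \<le> F x\<close> and
      \<open>F x \<le> 2 * power_sum p n v x\<close>.\<close>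
    also have "\<dots> \<le> 6 * power_sum p n v x" using y(2) Fx F1 by simp
    finally have *: "?a * (?W * ln 2 / (12 * ln n)) \<le> 6 * power_sum p n v x" .
    have "?a * (?W * (1/2) / (12 * ln n)) \<le> ?a * (?W * ln 2 / (12 * ln n))"
      using ln2 lnn a0 False by (intro mult_left_mono divide_right_mono) auto
    with * have "?a * (?W * (1/2) / (12 * ln n)) \<le> 6 * power_sum p n v x" by simp
    then show ?thesis by (simp add: field_simps)
  qed
qed

section \<open>From power sums to the norm problem\<close>

lemma norm_approxI:
  assumes d: "dim_col A \<ge> 1" and x: "x \<in> carrier_vec (dim_col A)" "x \<noteq> 0\<^sub>v (dim_col A)"
    and \<theta>: "\<theta> > 0"
    and le: "\<And>y. y \<in> carrier_vec (dim_col A) \<Longrightarrow> y \<noteq> 0\<^sub>v (dim_col A) \<Longrightarrow>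
      \<theta> * (lp_norm p (A *\<^sub>v y) / lp_norm q y) \<le> lp_norm p (A *\<^sub>v x) / lp_norm q x"
  shows "norm_approx q p \<theta> A x"
proof -
  \<comment> \<open>A bound on every ratio bounds the supremum, as the index set is nonempty: it
    contains \<open>x\<close>.\<close>
  have "op_norm q p A \<le> (lp_norm p (A *\<^sub>v x) / lp_norm q x) / \<theta>"
    unfolding op_norm_def
  proof (rule cSUP_least)
    fix y :: "real vec" assume "y \<in> {y \<in> carrier_vec (dim_col A). y \<noteq> 0\<^sub>v (dim_col A)}"
    then have "\<theta> * (lp_norm p (A *\<^sub>v y) / lp_norm q y) \<le> lp_norm p (A *\<^sub>v x) / lp_norm q x"
      using le by simp
    then show "lp_norm p (A *\<^sub>v y) / lp_norm q y \<le> (lp_norm p (A *\<^sub>v x) / lp_norm q x) / \<theta>"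
      by (simp only: pos_le_divide_eq[OF \<theta>] mult.commute)
  qed (use x in auto)
  then have "\<theta> * op_norm q p A \<le> lp_norm p (A *\<^sub>v x) / lp_norm q x"
    by (simp only: pos_le_divide_eq[OF \<theta>] mult.commute)
  then show ?thesis using x by (simp add: norm_approx_def)
qed

lemma lp_norm_mult_mat_vec:
  assumes A: "A \<in> carrier_mat n d" and x: "x \<in> carrier_vec d" and p: "p > 0" and m: "m > 0"
    and v: "\<And>i. i < n \<Longrightarrow> v i = (1 / m) \<cdot>\<^sub>v row A i"
  shows "lp_norm p (A *\<^sub>v x) = m * power_sum p n v x powr (1 / p)"
proof -
  have "\<bar>(A *\<^sub>v x) $ i\<bar> powr p = m powr p * \<bar>x \<bullet> v i\<bar> powr p" if "i < n" for i
  proof -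
    have "x \<bullet> v i = (1 / m) * (row A i \<bullet> x)"
      using that A x v by (simp add: comm_scalar_prod[of x d])
    then have "(A *\<^sub>v x) $ i = m * (x \<bullet> v i)" using that A m by simp
    then show ?thesis using m by (simp add: abs_mult powr_mult)
  qed
  then have "(\<Sum>i<n. \<bar>(A *\<^sub>v x) $ i\<bar> powr p) = m powr p * power_sum p n v x"
    by (simp add: power_sum_def sum_distrib_left)
  then show ?thesis
    using A m p power_sum_nonneg[of p n v x] by (simp add: lp_norm_def powr_mult powr_powr)
qed

text \<open>The ratios are invariant under scaling of \<open>y\<close>, so unit vectors
  \<open>u\<close> suffice. The scale \<open>m\<close> occurs on both sides, and the
  \<open>p\<close>-th root turns \<open>c\<close> into \<open>c powr (1 / p)\<close>.\<close>

lemma norm_approx_of_power_sum: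
  assumes A: "A \<in> carrier_mat n d" and d: "d \<ge> 1" and x: "x \<in> unit_sphere d" and p: "p > 2"
    and m: "m > 0" and v: "\<And>i. i < n \<Longrightarrow> v i = (1 / m) \<cdot>\<^sub>v row A i"
    and c: "c > 0" and \<theta>: "0 < \<theta>" "\<theta> \<le> c powr (1 / p)"
    and le: "\<And>u. u \<in> unit_sphere d \<Longrightarrow> c * power_sum p n v u \<le> power_sum p n v x"
  shows "norm_approx 2 p \<theta> A x"
proof (rule norm_approxI)
  have x': "x \<in> carrier_vec d" "lp_norm 2 x = 1" using x by (auto simp: unit_sphere_def)
  show "x \<in> carrier_vec (dim_col A)" using A x' by simp
  show "x \<noteq> 0\<^sub>v (dim_col A)"
  proof
    assume "x = 0\<^sub>v (dim_col A)"
    then have "lp_norm 2 x = 0" by (simp add: lp_norm_2)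
    then show False using x' by simp
  qed
  fix y :: "real vec" assume "y \<in> carrier_vec (dim_col A)" "y \<noteq> 0\<^sub>v (dim_col A)"
  then have y: "y \<in> carrier_vec d" "lp_norm 2 y > 0" using A by (auto intro: lp_norm_2_pos)
  define u where "u = (1 / lp_norm 2 y) \<cdot>\<^sub>v y"
  have u: "u \<in> unit_sphere d" using y by (simp add: unit_sphere_def u_def lp_norm_smult)
  have "A *\<^sub>v u = (1 / lp_norm 2 y) \<cdot>\<^sub>v (A *\<^sub>v y)"
    unfolding u_def using A y by (intro mult_mat_vec)
  then have "lp_norm p (A *\<^sub>v y) / lp_norm 2 y = lp_norm p (A *\<^sub>v u)"
    using p y by (simp add: lp_norm_smult)
  also have "\<dots> = m * power_sum p n v u powr (1 / p)"
    using u p by (intro lp_norm_mult_mat_vec[OF A _ _ m v]) (auto simp: unit_sphere_def)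
  finally have "\<theta> * (lp_norm p (A *\<^sub>v y) / lp_norm 2 y) \<le> c powr (1 / p) * (m * power_sum p n v u powr (1 / p))"
    using \<theta> m by (simp add: mult_right_mono)
  also have "\<dots> = m * (c * power_sum p n v u) powr (1 / p)"
    using c power_sum_nonneg[of p n v u] by (simp add: powr_mult)
  also have "\<dots> \<le> m * power_sum p n v x powr (1 / p)"
    using m p le[OF u] c power_sum_nonneg[of p n v u] by (intro mult_left_mono powr_mono2) auto
  also have "\<dots> = lp_norm p (A *\<^sub>v x) / lp_norm 2 x"
    using x' p by (simp add: lp_norm_mult_mat_vec[OF A _ _ m v])
  finally show "\<theta> * (lp_norm p (A *\<^sub>v y) / lp_norm 2 y) \<le> lp_norm p (A *\<^sub>v x) / lp_norm 2 x" .
qed (use A d \<theta> in auto)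

text \<open>The degenerate case in which no row can be scaled to norm 1: all ratios are 0.\<close>

lemma norm_approx_zero_rows:
  assumes A: "A \<in> carrier_mat n d" and d: "d \<ge> 1"
    and x: "x \<in> carrier_vec d" "x \<noteq> 0\<^sub>v d" and \<theta>: "\<theta> > 0"
    and zero: "\<And>i. i < n \<Longrightarrow> row A i = 0\<^sub>v d"
  shows "norm_approx 2 p \<theta> A x"
proof (rule norm_approxI)
  fix y :: "real vec" assume "y \<in> carrier_vec (dim_col A)"
  then have "lp_norm p (A *\<^sub>v y) = 0"
    using A zero by (simp add: lp_norm_def)
  then show "\<theta> * (lp_norm p (A *\<^sub>v y) / lp_norm 2 y) \<le> lp_norm p (A *\<^sub>v x) / lp_norm 2 x"
    by (simp add: lp_norm_def)
qed (use A d x \<theta> in auto)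

section \<open>The reduction as a program\<close>

definition flat_row :: "nat \<Rightarrow> (nat \<Rightarrow> real) \<Rightarrow> nat \<Rightarrow> real vec" where
  "flat_row d V i = vec d (\<lambda>j. V (i * d + j))"

lemma flat_row_index: "d \<ge> 1 \<Longrightarrow> flat_row d V (k div d) $ (k mod d) = V k"
  by (simp add: flat_row_def)

text \<open>Array names are literals of a program, so a range of arrays is cleared by an unrolled
  chain of commands. Its cost depends on \<open>m\<close> only and is constant for a fixed
  program.\<close>

primrec clear_below :: "nat \<Rightarrow> com" where
  "clear_below 0 = Skip"
| "clear_below (Suc m) = Seq (clear_below m) (Seq (NClear m) (RClear m))"

lemma nmods_clear_below [simp]: "nmods (clear_below m) = {..<m}"
  and rmods_clear_below [simp]: "rmods (clear_below m) = {..<m}"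
  by (induction m) (simp_all add: lessThan_Suc)

lemma wp_clear_below:
  "wp (clear_below m) s (\<lambda>t s'. t = 2 * m + 1 \<and> (\<forall>a<m. nats s' a = (\<lambda>_. 0) \<and> reals s' a = (\<lambda>_. 0)))"
proof (induction m)
  case (Suc m)
  show ?case
    unfolding clear_below.simps wp_Seq
    by (rule wp_mono[OF Suc]) (auto simp: less_Suc_eq)
qed simp

lemma wp_fill:
  assumes "a \<noteq> b" "nats s b 0 = m"
    and e: "\<And>j u. j < m \<Longrightarrow> nats u a 0 = j \<Longrightarrow> frame {a} {x} s u \<Longrightarrow> rval e u = f j"
  shows "wp (for_loop a b (RSet x (nvar a) e)) s
    (\<lambda>t s'. t \<le> 3 * m + 2 \<and> reals s' x = (\<lambda>j. if j < m then f j else reals s x j))"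
proof (rule wp_mono[OF wp_for_loop[where m = m and T = 1 and
      I = "\<lambda>k s'. reals s' x = (\<lambda>j. if j < k then f j else reals s x j)"]])
  fix k u
  assume "k < m" "reals u x = (\<lambda>j. if j < k then f j else reals s x j)" "nats u a 0 = k"
    "frame (insert a (nmods (RSet x (nvar a) e))) (rmods (RSet x (nvar a) e)) s u"
  then show "wp (RSet x (nvar a) e) u (\<lambda>t u'. t \<le> 1 \<and>
      reals (nset a 0 (Suc k) u') x = (\<lambda>j. if j < Suc k then f j else reals s x j))"
    using e[of k u] by auto
qed (use assms in auto)

text \<open>\<open>P\<close> is the TC program; it owns the arrays below \<open>N + 4\<close>, among them the input and output
  arrays 0 to 3. The reduction keeps its own data in the arrays from \<open>N + 4\<close> on, using cell 0 of an
  array for each scalar variable.\<close>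

locale tc_reduction =
  fixes N :: nat and r :: real and P :: com
  assumes used_P: "used P \<subseteq> {..<N + 4}"
begin

abbreviation "aRows \<equiv> N + 4"
abbreviation "aCols \<equiv> N + 5"
abbreviation "aSize \<equiv> N + 6"
abbreviation "aLevels \<equiv> N + 7"
abbreviation "aK \<equiv> N + 8"
abbreviation "aI \<equiv> N + 9"
abbreviation "aJ \<equiv> N + 10"
abbreviation "aPos \<equiv> N + 11"
abbreviation "aRow \<equiv> N + 12"
abbreviation "aL \<equiv> N + 13"

abbreviation "rRows \<equiv> N + 4"
abbreviation "rMax \<equiv> N + 5"
abbreviation "rAcc \<equiv> N + 6"
abbreviation "rLev \<equiv> N + 7"
abbreviation "rWt \<equiv> N + 8"
abbreviation "rScore \<equiv> N + 9"
abbreviation "rBest \<equiv> N + 10"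
abbreviation "rSol \<equiv> N + 11"
abbreviation "rTau \<equiv> N + 12"

text \<open>Naturals cannot be multiplied, so the offset \<open>i * d + j\<close> is maintained in
  \<open>aPos\<close>, which advances by one per cell and ends at the start of the next row.\<close>

definition row_sum :: "rexp \<Rightarrow> com" where
  "row_sum e = Seq (rassign rAcc (RConst 0))
    (for_loop aJ aCols (Seq (rassign rAcc (RAdd (rvar rAcc) e)) (incr aPos)))"

lemma row_sum_mods [simp]: "nmods (row_sum e) = {aJ, aPos}" "rmods (row_sum e) = {rAcc}"
  by (auto simp: row_sum_def)

lemma wp_row_sum:
  assumes "nats s aCols 0 = d" "nats s aPos 0 = q"
    and e: "\<And>j u. j < d \<Longrightarrow> nats u aJ 0 = j \<Longrightarrow> nats u aPos 0 = q + j \<Longrightarrow>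
      frame {aJ, aPos} {rAcc} s u \<Longrightarrow> rval e u = f j"
  shows "wp (row_sum e) s (\<lambda>t s'. t \<le> 4 * d + 3 \<and> nats s' aPos 0 = q + d \<and> reals s' rAcc 0 = (\<Sum>j<d. f j))"
proof -
  let ?c = "Seq (rassign rAcc (RAdd (rvar rAcc) e)) (incr aPos)"
  have "wp (for_loop aJ aCols ?c) (rset rAcc 0 0 s)
    (\<lambda>t s'. t \<le> d * (2 + 2) + 2 \<and> nats s' aPos 0 = q + d \<and> reals s' rAcc 0 = (\<Sum>j<d. f j))"
  proof (rule wp_for_loop[where I = "\<lambda>k s'. nats s' aPos 0 = q + k \<and> reals s' rAcc 0 = (\<Sum>j<k. f j)"])
    fix k u
    assume "k < d" "nats u aPos 0 = q + k \<and> reals u rAcc 0 = (\<Sum>j<k. f j)" "nats u aJ 0 = k"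
      "frame (insert aJ (nmods ?c)) (rmods ?c) (rset rAcc 0 0 s) u"
    moreover from this(4) have "frame {aJ, aPos} {rAcc} s u" by (auto simp: frame_def)
    ultimately show "wp ?c u (\<lambda>t u'. t \<le> 2 \<and> nats (nset aJ 0 (Suc k) u') aPos 0 = q + Suc k \<and>
        reals (nset aJ 0 (Suc k) u') rAcc 0 = (\<Sum>j<Suc k. f j))"
      using e[of k u] by simp
  qed (use assms in auto)
  then show ?thesis
    unfolding row_sum_def by (simp add: mult.commute)
qed

text \<open>Comparing squared norms selects the same row. After \<open>row_sum\<close> the position
  is already one row ahead, hence the subtraction of \<open>aCols\<close>.\<close>

definition max_row :: com where
  "max_row = for_loop aI aRows
    (Seq (row_sum (RMul (RCell 0 (nvar aPos)) (RCell 0 (nvar aPos))))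
      (If (RLess (rvar rMax) (rvar rAcc))
        (Seq (rassign rMax (rvar rAcc)) (nassign aRow (NSub (nvar aPos) (nvar aCols)))) Skip))"

lemma max_row_mods [simp]:
  "nmods max_row = {aI, aJ, aPos, aRow}" "rmods max_row = {rAcc, rMax}"
  by (auto simp: max_row_def)

lemma wp_max_row:
  assumes "nats s aRows 0 = n" "nats s aCols 0 = d" "nats s aPos 0 = 0" "reals s rMax 0 = 0"
  defines "R \<equiv> \<lambda>i. \<Sum>j<d. (reals s 0 (i * d + j))\<^sup>2"
  shows "wp max_row s (\<lambda>t s'. t \<le> n * (4 * d + 8) + 2 \<and> nats s' aPos 0 = n * d \<and>
    0 \<le> reals s' rMax 0 \<and> (\<forall>i<n. R i \<le> reals s' rMax 0) \<and>
    (reals s' rMax 0 = 0 \<or> (\<exists>i<n. nats s' aRow 0 = i * d \<and> reals s' rMax 0 = R i)))"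
proof -
  let ?e = "RMul (RCell 0 (nvar aPos)) (RCell 0 (nvar aPos))"
  let ?If = "If (RLess (rvar rMax) (rvar rAcc))
    (Seq (rassign rMax (rvar rAcc)) (nassign aRow (NSub (nvar aPos) (nvar aCols)))) Skip"
  \<comment> \<open>Only a positive sum replaces the initial maximum 0, so \<open>aRow\<close> is
    meaningful once the maximum is nonzero.\<close>
  let ?I = "\<lambda>k s'. nats s' aPos 0 = k * d \<and> 0 \<le> reals s' rMax 0 \<and>
    (\<forall>i<k. R i \<le> reals s' rMax 0) \<and>
    (reals s' rMax 0 = 0 \<or> (\<exists>i<k. nats s' aRow 0 = i * d \<and> reals s' rMax 0 = R i))"
  have "wp max_row s (\<lambda>t s'. t \<le> n * (4 * d + 6 + 2) + 2 \<and> ?I n s')"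
    unfolding max_row_def
  proof (rule wp_for_loop[where I = ?I])
    fix k u
    assume *: "k < n" "?I k u"
      "frame (insert aI (nmods (Seq (row_sum ?e) ?If))) (rmods (Seq (row_sum ?e) ?If)) s u"
    have uA: "reals u 0 = reals s 0" and ud: "nats u aCols 0 = d"
      using *(3) assms by (auto simp: frame_def)
    have 1: "wp (row_sum ?e) u (\<lambda>t s'. t \<le> 4 * d + 3 \<and> nats s' aPos 0 = k * d + d \<and>
        reals s' rAcc 0 = (\<Sum>j<d. (reals s 0 (k * d + j))\<^sup>2))"
      by (rule wp_row_sum) (use * ud uA in \<open>auto simp: frame_def power2_eq_square\<close>)
    show "wp (Seq (row_sum ?e) ?If) u (\<lambda>t u'. t \<le> 4 * d + 6 \<and> ?I (Suc k) (nset aI 0 (Suc k) u'))"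
      unfolding wp_Seq
    proof (rule wp_conseq[OF 1])
      fix t s'
      assume s': "t \<le> 4 * d + 3 \<and> nats s' aPos 0 = k * d + d \<and>
          reals s' rAcc 0 = (\<Sum>j<d. (reals s 0 (k * d + j))\<^sup>2)"
        and fr: "frame (nmods (row_sum ?e)) (rmods (row_sum ?e)) u s'"
      have acc: "reals s' rAcc 0 = R k" using s' by (simp add: R_def)
      have eqs: "nats s' aCols 0 = d" "nats s' aRow 0 = nats u aRow 0" "reals s' rMax 0 = reals u rMax 0"
        using fr ud by (auto simp: frame_def)
      have "R k \<ge> 0" by (simp add: R_def sum_nonneg)
      then show "wp ?If s' (\<lambda>t'. (\<lambda>t u'. t \<le> 4 * d + 6 \<and> ?I (Suc k) (nset aI 0 (Suc k) u')) (t + t'))"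
        using * s' acc eqs
        by (auto simp: less_Suc_eq intro: order.trans[OF _ less_imp_le])
    qed
  qed (use assms in auto)
  then show ?thesis by (rule wp_mono) (simp add: algebra_simps)
qed

text \<open>One operation per round updates each of \<open>r ^ l\<close> and
  \<open>(1/2) ^ l\<close>. The weight is added in the \<open>else\<close> branch because only
  strict comparison is available.\<close>

definition level_loop :: com where
  "level_loop = for_loop aL aLevels
    (Seq (If (RLess (rvar rAcc) (rvar rLev)) Skip (rassign rScore (RAdd (rvar rScore) (rvar rWt))))
      (Seq (rassign rLev (RMul (rvar rLev) (RConst r))) (rassign rWt (RDiv (rvar rWt) (RConst 2)))))"

lemma level_loop_mods [simp]: "nmods level_loop = {aL}" "rmods level_loop = {rScore, rLev, rWt}"
  by (auto simp: level_loop_def)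

lemma wp_level_loop:
  assumes "nats s aLevels 0 = K" "reals s rLev 0 = 1" "reals s rWt 0 = 1"
  shows "wp level_loop s (\<lambda>t s'. t \<le> 6 * K + 2 \<and>
    reals s' rScore 0 = reals s rScore 0 + level_score r K (reals s rAcc 0))"
proof -
  let ?I = "\<lambda>k s'. reals s' rLev 0 = r ^ k \<and> reals s' rWt 0 = (1/2) ^ k \<and>
    reals s' rScore 0 = reals s rScore 0 + level_score r k (reals s rAcc 0)"
  have "wp level_loop s (\<lambda>t s'. t \<le> K * (4 + 2) + 2 \<and> ?I K s')"
    unfolding level_loop_def
    by (rule wp_for_loop[where I = ?I]) (use assms in \<open>auto simp: level_score_def frame_def\<close>)
  then show ?thesis by (rule wp_mono) (simp add: mult.commute)
qed

text \<open>The candidate is scored in array 3, where \<open>P\<close> leaves its output. The square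
  root of the square replaces the absolute value, which is not an operation of the machine.\<close>

definition eval_candidate :: com where
  "eval_candidate = Seq (rassign rScore (RConst 0)) (Seq (nassign aPos (NConst 0))
    (for_loop aI aRows
      (Seq (row_sum (RMul (RCell 3 (nvar aJ)) (RCell rRows (nvar aPos))))
        (Seq (rassign rAcc (RSqrt (RMul (rvar rAcc) (rvar rAcc))))
          (Seq (rassign rLev (RConst 1)) (Seq (rassign rWt (RConst 1)) level_loop))))))"

lemma eval_candidate_mods [simp]: "nmods eval_candidate = {aI, aJ, aL, aPos}"
  "rmods eval_candidate = {rAcc, rLev, rWt, rScore}"
  by (auto simp: eval_candidate_def)

lemma wp_eval_candidate:
  assumes s: "nats s aRows 0 = n" "nats s aCols 0 = d" "nats s aLevels 0 = K"
  shows "wp eval_candidate s (\<lambda>t s'. t \<le> n * (4 * d + 6 * K + 10) + 4 \<and>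
    reals s' rScore 0 = vec_score r K n (flat_row d (reals s rRows)) (output_vec d s))"
proof -
  let ?e = "RMul (RCell 3 (nvar aJ)) (RCell rRows (nvar aPos))"
  let ?c = "Seq (rassign rAcc (RSqrt (RMul (rvar rAcc) (rvar rAcc))))
          (Seq (rassign rLev (RConst 1)) (Seq (rassign rWt (RConst 1)) level_loop))"
  let ?s = "nset aPos 0 0 (rset rScore 0 0 s)"
  let ?x = "output_vec d s" and ?v = "flat_row d (reals s rRows)"
  let ?I = "\<lambda>k s'. nats s' aPos 0 = k * d \<and> reals s' rScore 0 = vec_score r K k ?v ?x"
  have "wp (for_loop aI aRows (Seq (row_sum ?e) ?c)) ?s (\<lambda>t s'. t \<le> n * (4 * d + 6 * K + 8 + 2) + 2 \<and> ?I n s')"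
  proof (rule wp_for_loop[where I = ?I])
    fix k u
    assume *: "k < n" "?I k u"
      "frame (insert aI (nmods (Seq (row_sum ?e) ?c))) (rmods (Seq (row_sum ?e) ?c)) ?s u"
    have ud: "nats u aCols 0 = d" "nats u aLevels 0 = K" "reals u 3 = reals s 3" "reals u rRows = reals s rRows"
      using *(3) s by (auto simp: frame_def)
    have 1: "wp (row_sum ?e) u (\<lambda>t s'. t \<le> 4 * d + 3 \<and> nats s' aPos 0 = k * d + d \<and>
        reals s' rAcc 0 = (\<Sum>j<d. reals s 3 j * reals s rRows (k * d + j)))"
      by (rule wp_row_sum) (use * ud in \<open>auto simp: frame_def\<close>)
    have dot: "(\<Sum>j<d. reals s 3 j * reals s rRows (k * d + j)) = ?x \<bullet> ?v k"
      by (simp add: scalar_prod_def output_vec_def flat_row_def atLeast0LessThan)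
    show "wp (Seq (row_sum ?e) ?c) u (\<lambda>t u'. t \<le> 4 * d + 6 * K + 8 \<and> ?I (Suc k) (nset aI 0 (Suc k) u'))"
      unfolding wp_Seq[of "row_sum ?e"]
    proof (rule wp_conseq[OF 1])
      fix t s'
      assume s': "t \<le> 4 * d + 3 \<and> nats s' aPos 0 = k * d + d \<and>
          reals s' rAcc 0 = (\<Sum>j<d. reals s 3 j * reals s rRows (k * d + j))"
        and fr: "frame (nmods (row_sum ?e)) (rmods (row_sum ?e)) u s'"
      have acc: "sqrt (reals s' rAcc 0 * reals s' rAcc 0) = \<bar>?x \<bullet> ?v k\<bar>"
        using s' dot by simp
      define s2 where "s2 = rset rWt 0 1 (rset rLev 0 1 (rset rAcc 0 \<bar>?x \<bullet> ?v k\<bar> s'))"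
      have "nats s2 aLevels 0 = K" "reals s2 rLev 0 = 1" "reals s2 rWt 0 = 1"
        "reals s2 rAcc 0 = \<bar>?x \<bullet> ?v k\<bar>" "reals s2 rScore 0 = vec_score r K k ?v ?x"
        "nats s2 aPos 0 = k * d + d"
        using fr ud * s' by (auto simp: frame_def s2_def)
      note s2 = this
      have "wp level_loop s2 (\<lambda>t' u'. t + 3 + t' \<le> 4 * d + 6 * K + 8 \<and> ?I (Suc k) (nset aI 0 (Suc k) u'))"
        by (rule wp_conseq[OF wp_level_loop[OF s2(1-3)]])
          (use s2 s' in \<open>auto simp: frame_def vec_score_def\<close>)
      then show "wp ?c s' (\<lambda>t'. (\<lambda>t u'. t \<le> 4 * d + 6 * K + 8 \<and> ?I (Suc k) (nset aI 0 (Suc k) u')) (t + t'))"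
        using acc by (simp add: s2_def numeral_3_eq_3)
    qed
  qed (use assms in \<open>auto simp: vec_score_def\<close>)
  then show ?thesis
    unfolding eval_candidate_def by simp (erule wp_mono, simp add: algebra_simps)
qed

text \<open>The next call of \<open>P\<close> destroys array 3, so the current leader is saved in
  \<open>rSol\<close>.\<close>

definition try_candidate :: com where
  "try_candidate = Seq eval_candidate (If (RLess (rvar rBest) (rvar rScore))
    (Seq (rassign rBest (rvar rScore)) (for_loop aJ aCols (RSet rSol (nvar aJ) (RCell 3 (nvar aJ))))) Skip)"

lemma try_candidate_mods [simp]: "nmods try_candidate = {aI, aJ, aL, aPos}"
  "rmods try_candidate = {rAcc, rLev, rWt, rScore, rBest, rSol}"
  by (auto simp: try_candidate_def)

lemma wp_try_candidate:
  assumes s: "nats s aRows 0 = n" "nats s aCols 0 = d" "nats s aLevels 0 = K"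
  defines "F \<equiv> vec_score r K n (flat_row d (reals s rRows)) (output_vec d s)"
  shows "wp try_candidate s (\<lambda>t s'. t \<le> n * (4 * d + 6 * K + 10) + 3 * d + 8 \<and>
    (if reals s rBest 0 < F then reals s' rBest 0 = F \<and> vec d (reals s' rSol) = output_vec d s
     else reals s' rBest 0 = reals s rBest 0 \<and> vec d (reals s' rSol) = vec d (reals s rSol)))"
    (is "wp _ _ ?Q")
proof -
  let ?fill = "for_loop aJ aCols (RSet rSol (nvar aJ) (RCell 3 (nvar aJ)))"
  let ?If = "If (RLess (rvar rBest) (rvar rScore)) (Seq (rassign rBest (rvar rScore)) ?fill) Skip"
  show ?thesis
    unfolding try_candidate_def wp_Seq[of eval_candidate]
  proof (rule wp_conseq[OF wp_eval_candidate[OF s]])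
    fix t s'
    assume s': "t \<le> n * (4 * d + 6 * K + 10) + 4 \<and>
        reals s' rScore 0 = vec_score r K n (flat_row d (reals s rRows)) (output_vec d s)"
      and fr: "frame (nmods eval_candidate) (rmods eval_candidate) s s'"
    have eqs: "reals s' rScore 0 = F" "reals s' rBest 0 = reals s rBest 0"
      "reals s' rSol = reals s rSol" "reals s' 3 = reals s 3" "nats s' aCols 0 = d"
      using s' fr s by (auto simp: F_def frame_def)
    show "wp ?If s' (\<lambda>t'. ?Q (t + t'))"
    proof (cases "reals s rBest 0 < F")
      case True
      let ?s = "rset rBest 0 F s'"
      have "wp ?fill ?s (\<lambda>t u. t \<le> 3 * d + 2 \<and>
          reals u rSol = (\<lambda>j. if j < d then reals s 3 j else reals ?s rSol j))"
        by (rule wp_fill) (use eqs in \<open>auto simp: frame_def\<close>)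
      then have "wp ?fill ?s (\<lambda>t' u. ?Q (t + (t' + 2)) u)"
        by (rule wp_conseq) (use True s' in \<open>auto simp: frame_def output_vec_def\<close>)
      then show ?thesis using True eqs by simp
    qed (use eqs s' in simp)
  qed
qed

section \<open>Running the threshold correlation program\<close>

definition call_tc :: com where
  "call_tc = Seq (clear_below (N + 4))
    (Seq (NSet 0 (NConst 0) (nvar aRows)) (Seq (NSet 0 (NConst 1) (nvar aCols))
      (Seq (for_loop aJ aSize (RSet 0 (nvar aJ) (RCell rRows (nvar aJ))))
        (Seq (for_loop aJ aRows (RSet 1 (nvar aJ) (RConst 1)))
          (Seq (RSet 2 (NConst 0) (rvar rTau)) P)))))"

lemma call_tc_mods [simp]: "nmods call_tc = insert aJ {..<N + 4}" "rmods call_tc = {..<N + 4}"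
  using used_P nmods_subset_used[of P] rmods_subset_used[of P] by (auto simp: call_tc_def)

text \<open>\<open>P\<close> is specified on memories that vanish outside its input, so every array
  it may touch is reset first. The memory then differs from \<open>tc_input\<close> only in arrays
  foreign to \<open>P\<close>, and \<open>exec_agree\<close> transfers the run with its step
  count.\<close>

lemma wp_call_tc:
  assumes s: "nats s aRows 0 = n" "nats s aCols 0 = d" "nats s aSize 0 = n * d"
    and d: "d \<ge> 1"
    and P: "exec P (tc_input n d (flat_row d (reals s rRows)) (\<lambda>_. 1) (reals s rTau 0)) t0 s0"
  shows "wp call_tc s (\<lambda>t s'. t \<le> 2 * N + 3 * (n * d) + 3 * n + 16 + t0 \<and>
    output_vec d s' = output_vec d s0)" (is "wp _ _ ?Q")
proof -
  let ?f1 = "for_loop aJ aSize (RSet 0 (nvar aJ) (RCell rRows (nvar aJ)))"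
  let ?f2 = "for_loop aJ aRows (RSet 1 (nvar aJ) (RConst 1))"
  let ?V = "reals s rRows"
  show ?thesis
    unfolding call_tc_def wp_Seq[of "clear_below (N + 4)"]
  proof (rule wp_conseq[OF wp_clear_below])
    fix t1 s1
    assume s1: "t1 = 2 * (N + 4) + 1 \<and> (\<forall>a<N + 4. nats s1 a = (\<lambda>_. 0) \<and> reals s1 a = (\<lambda>_. 0))"
      and fr1: "frame (nmods (clear_below (N + 4))) (rmods (clear_below (N + 4))) s s1"
    have e1: "nats s1 aRows 0 = n" "nats s1 aCols 0 = d" "nats s1 aSize 0 = n * d"
      "reals s1 rRows = ?V" "reals s1 rTau = reals s rTau"
      using fr1 s by (auto simp: frame_def)
    define s2 where "s2 = nset 0 1 d (nset 0 0 n s1)"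
    have e2: "nats s2 aRows 0 = n" "nats s2 aCols 0 = d" "nats s2 aSize 0 = n * d"
      "reals s2 rRows = ?V" "reals s2 rTau = reals s rTau"
      "\<And>a. a < N + 4 \<Longrightarrow> reals s2 a = (\<lambda>_. 0)"
      "\<And>a. a < N + 4 \<Longrightarrow> nats s2 a = (if a = 0 then (\<lambda>_. 0)(0 := n, 1 := d) else (\<lambda>_. 0))"
      using e1 s1 by (auto simp: s2_def fun_eq_iff)
    have f1: "wp ?f1 s2 (\<lambda>t u. t \<le> 3 * (n * d) + 2 \<and>
        reals u 0 = (\<lambda>j. if j < n * d then ?V j else reals s2 0 j))"
      by (rule wp_fill) (use e2 in \<open>auto simp: frame_def\<close>)
    have "wp (Seq ?f1 (Seq ?f2 (Seq (RSet 2 (NConst 0) (rvar rTau)) P))) s2 (\<lambda>t'. ?Q (t1 + (2 + t')))"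
      unfolding wp_Seq[of ?f1]
    proof (rule wp_conseq[OF f1])
      fix t3 s3
      assume s3: "t3 \<le> 3 * (n * d) + 2 \<and>
          reals s3 0 = (\<lambda>j. if j < n * d then ?V j else reals s2 0 j)"
        and fr3: "frame (nmods ?f1) (rmods ?f1) s2 s3"
      have e3: "nats s3 aRows 0 = n" "reals s3 rTau = reals s rTau"
        "\<And>a. a < N + 4 \<Longrightarrow> nats s3 a = (if a = 0 then (\<lambda>_. 0)(0 := n, 1 := d) else (\<lambda>_. 0))"
        "\<And>a. a < N + 4 \<Longrightarrow> reals s3 a =
          (if a = 0 then (\<lambda>j. if j < n * d then ?V j else 0) else (\<lambda>_. 0))"
        using fr3 e2 s3 by (auto simp: frame_def)
      have f2: "wp ?f2 s3 (\<lambda>t u. t \<le> 3 * n + 2 \<and>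
          reals u 1 = (\<lambda>j. if j < n then 1 else reals s3 1 j))"
        by (rule wp_fill) (use e3 in \<open>auto simp: frame_def\<close>)
      show "wp (Seq ?f2 (Seq (RSet 2 (NConst 0) (rvar rTau)) P)) s3 (\<lambda>t'. ?Q (t1 + (2 + (t3 + t'))))"
        unfolding wp_Seq[of ?f2]
      proof (rule wp_conseq[OF f2])
        fix t4 s4
        assume s4: "t4 \<le> 3 * n + 2 \<and> reals s4 1 = (\<lambda>j. if j < n then 1 else reals s3 1 j)"
          and fr4: "frame (nmods ?f2) (rmods ?f2) s3 s4"
        have e4: "reals s4 rTau = reals s rTau"
          "\<And>a. a < N + 4 \<Longrightarrow> nats s4 a = (if a = 0 then (\<lambda>_. 0)(0 := n, 1 := d) else (\<lambda>_. 0))"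
          "\<And>a. a < N + 4 \<Longrightarrow> reals s4 a =
            (if a = 0 then (\<lambda>j. if j < n * d then ?V j else 0)
             else if a = 1 then (\<lambda>j. if j < n then 1 else 0) else (\<lambda>_. 0))"
          using fr4 e3 s4 by (auto simp: frame_def)
        let ?s5 = "rset 2 0 (reals s rTau 0) s4"
        have "agree {..<N + 4} (tc_input n d (flat_row d ?V) (\<lambda>_. 1) (reals s rTau 0)) ?s5"
          using d e4 by (auto simp: frame_def tc_input_def input_mem_def flat_row_index fun_eq_iff)
        from exec_agree[OF P this used_P] obtain u where
          u: "exec P ?s5 t0 u" "agree {..<N + 4} s0 u" by blast
        have "output_vec d u = output_vec d s0"
          using u(2) by (simp add: output_vec_def frame_def)
        then have "?Q (t1 + (2 + (t3 + (t4 + (1 + t0))))) u"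
          using s1 s3 s4 by simp
        with u(1) have "wp P ?s5 (\<lambda>t'. ?Q (t1 + (2 + (t3 + (t4 + (1 + t'))))))"
          unfolding wp_def by blast
        then show "wp (Seq (RSet 2 (NConst 0) (rvar rTau)) P) s4
            (\<lambda>t'. ?Q (t1 + (2 + (t3 + (t4 + t')))))"
          using e4(1) by simp
      qed
    qed
    then show "wp (Seq (NSet 0 (NConst 0) (nvar aRows)) (Seq (NSet 0 (NConst 1) (nvar aCols))
        (Seq ?f1 (Seq ?f2 (Seq (RSet 2 (NConst 0) (rvar rTau)) P))))) s1 (\<lambda>t'. ?Q (t1 + t'))"
      using e1 by (simp add: s2_def)
  qed
qed

section \<open>Trying all thresholds\<close>

definition tc_loop :: com where
  "tc_loop = for_loop aK aLevels
    (Seq call_tc (Seq try_candidate (rassign rTau (RMul (rvar rTau) (RConst (r * r))))))"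

lemma tc_loop_mods [simp]:
  "nmods tc_loop = {aI, aJ, aL, aPos, aK} \<union> {..<N + 4}"
  "rmods tc_loop = {rAcc, rLev, rWt, rScore, rBest, rSol, rTau} \<union> {..<N + 4}"
  by (auto simp: tc_loop_def)

text \<open>\<open>G k\<close> abstracts the guarantee on the output of round \<open>k\<close>.
  Losing candidates are not stored, so the invariant records only that some \<open>y\<close> with
  \<open>G k y\<close> scored no more than the current leader.\<close>

lemma wp_tc_loop:
  fixes G :: "nat \<Rightarrow> real vec \<Rightarrow> bool"
  assumes s: "nats s aRows 0 = n" "nats s aCols 0 = d" "nats s aSize 0 = n * d" "nats s aLevels 0 = K"
      "reals s rTau 0 = r * r"
    and d: "d \<ge> 1"
    and F: "F = vec_score r K n (flat_row d (reals s rRows))"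
    and best: "reals s rBest 0 = F (vec d (reals s rSol))"
    and P: "\<And>k. k < K \<Longrightarrow> \<exists>t0 s0.
      exec P (tc_input n d (flat_row d (reals s rRows)) (\<lambda>_. 1) (r ^ (2 * k + 2))) t0 s0 \<and>
      t0 \<le> B \<and> G k (output_vec d s0)"
  shows "wp tc_loop s (\<lambda>t s'.
    t \<le> K * (2 * N + 3 * (n * d) + 3 * n + B + n * (4 * d + 6 * K + 10) + 3 * d + 27) + 2 \<and>
    (vec d (reals s' rSol) = vec d (reals s rSol) \<or> (\<exists>k<K. G k (vec d (reals s' rSol)))) \<and>
    F (vec d (reals s rSol)) \<le> F (vec d (reals s' rSol)) \<and>
    (\<forall>k<K. \<exists>y. G k y \<and> F y \<le> F (vec d (reals s' rSol))))"
proof -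
  let ?upd = "rassign rTau (RMul (rvar rTau) (RConst (r * r)))"
  let ?c = "Seq call_tc (Seq try_candidate ?upd)"
  let ?T1 = "2 * N + 3 * (n * d) + 3 * n + 16 + B"
  let ?T2 = "n * (4 * d + 6 * K + 10) + 3 * d + 8"
  let ?sol = "vec d (reals s rSol)"
  let ?J = "\<lambda>k u. (vec d (reals u rSol) = ?sol \<or> (\<exists>k'<k. G k' (vec d (reals u rSol)))) \<and>
    F ?sol \<le> F (vec d (reals u rSol)) \<and> (\<forall>k'<k. \<exists>y. G k' y \<and> F y \<le> F (vec d (reals u rSol)))"
  let ?I = "\<lambda>k u. reals u rTau 0 = r ^ (2 * k + 2) \<and>
    reals u rBest 0 = F (vec d (reals u rSol)) \<and> ?J k u"
  have "wp tc_loop s (\<lambda>t s'. t \<le> K * ((?T1 + (?T2 + 1)) + 2) + 2 \<and> ?I K s')"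
    unfolding tc_loop_def
  proof (rule wp_for_loop[where I = ?I])
    fix k u
    assume k: "k < K" and I: "?I k u" and fr: "frame (insert aK (nmods ?c)) (rmods ?c) s u"
    have u: "nats u aRows 0 = n" "nats u aCols 0 = d" "nats u aSize 0 = n * d" "nats u aLevels 0 = K"
      "reals u rRows = reals s rRows"
      using fr s by (auto simp: frame_def)
    obtain t0 s0 where P0: "exec P (tc_input n d (flat_row d (reals u rRows)) (\<lambda>_. 1) (reals u rTau 0)) t0 s0"
      and t0: "t0 \<le> B" and G: "G k (output_vec d s0)"
      using P[OF k] I u(5) by auto
    let ?x = "output_vec d s0"
    show "wp ?c u (\<lambda>t u'. t \<le> ?T1 + (?T2 + 1) \<and> ?I (Suc k) (nset aK 0 (Suc k) u'))"
      unfolding wp_Seq[of call_tc]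
    proof (rule wp_conseq[OF wp_call_tc[OF u(1-3) d P0]])
      fix t1 s1
      assume s1: "t1 \<le> 2 * N + 3 * (n * d) + 3 * n + 16 + t0 \<and> output_vec d s1 = ?x"
        and fr1: "frame (nmods call_tc) (rmods call_tc) u s1"
      have e1: "nats s1 aRows 0 = n" "nats s1 aCols 0 = d" "nats s1 aLevels 0 = K"
        "reals s1 rRows = reals s rRows" "reals s1 rTau = reals u rTau"
        "reals s1 rBest = reals u rBest" "reals s1 rSol = reals u rSol"
        using fr1 u by (auto simp: frame_def)
      show "wp (Seq try_candidate ?upd) s1
        (\<lambda>t'. (\<lambda>t u'. t \<le> ?T1 + (?T2 + 1) \<and> ?I (Suc k) (nset aK 0 (Suc k) u')) (t1 + t'))"
        unfolding wp_Seq
      proof (rule wp_conseq[OF wp_try_candidate[OF e1(1-3)]])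
        fix t2 s2
        assume s2: "t2 \<le> ?T2 \<and>
          (if reals s1 rBest 0 < vec_score r K n (flat_row d (reals s1 rRows)) (output_vec d s1)
           then reals s2 rBest 0 = vec_score r K n (flat_row d (reals s1 rRows)) (output_vec d s1) \<and>
             vec d (reals s2 rSol) = output_vec d s1
           else reals s2 rBest 0 = reals s1 rBest 0 \<and> vec d (reals s2 rSol) = vec d (reals s1 rSol))"
          and fr2: "frame (nmods try_candidate) (rmods try_candidate) s1 s2"
        have tau: "reals s2 rTau 0 = r ^ (2 * k + 2)"
          using fr2 e1 I by (simp add: frame_def)
        have t: "t1 + (t2 + 1) \<le> ?T1 + (?T2 + 1)" using s1 s2 t0 by simp
        have "if F (vec d (reals u rSol)) < F ?x then reals s2 rBest 0 = F ?x \<and> vec d (reals s2 rSol) = ?x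
          else reals s2 rBest 0 = F (vec d (reals u rSol)) \<and> vec d (reals s2 rSol) = vec d (reals u rSol)"
          using s2 s1 e1 I by (simp add: F)
        then have J: "reals s2 rBest 0 = F (vec d (reals s2 rSol)) \<and> ?J (Suc k) s2"
        proof (cases "F (vec d (reals u rSol)) < F ?x")
          case True
          then have sol: "vec d (reals s2 rSol) = ?x" "reals s2 rBest 0 = F ?x"
            using \<open>if _ then _ else _\<close> by simp_all
          have "\<exists>y. G k' y \<and> F y \<le> F ?x" if k': "k' < Suc k" for k'
          proof (cases "k' = k")
            case False
            then have "k' < k" using k' by simp
            then obtain y where "G k' y" "F y \<le> F (vec d (reals u rSol))" using I by blast
            then show ?thesis using True by (intro exI[of _ y]) simp
          qed (use G in auto)
          moreover have "F ?sol \<le> F ?x" using I True by simp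
          ultimately show ?thesis using sol G by auto
        next
          case False
          then have sol: "vec d (reals s2 rSol) = vec d (reals u rSol)"
            "reals s2 rBest 0 = F (vec d (reals u rSol))"
            using \<open>if _ then _ else _\<close> by simp_all
          show ?thesis unfolding sol using I False G by (auto simp: less_Suc_eq)
        qed
        show "wp ?upd s2 (\<lambda>t'. (\<lambda>t'. (\<lambda>t u'. t \<le> ?T1 + (?T2 + 1) \<and>
            ?I (Suc k) (nset aK 0 (Suc k) u')) (t1 + t')) (t2 + t'))"
          using tau t J by (simp add: power_add power2_eq_square)
      qed
    qed
  qed (use s best in \<open>auto simp: F power2_eq_square\<close>)
  then show ?thesis by (rule wp_mono) (simp add: algebra_simps)
qed

text \<open>The scan in \<open>max_row\<close> ends at position \<open>n * d\<close>, which supplies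
  the matrix size without multiplication. Scores are nonnegative, so the initial best
  \<open>-1\<close> makes the first candidate, the longest scaled row, win.\<close>

definition search :: com where
  "search = Seq (nassign aSize (nvar aPos)) (Seq (nassign aLevels (NAdd (nvar aRows) (NConst 1)))
    (Seq (for_loop aJ aSize (RSet rRows (nvar aJ) (RDiv (RCell 0 (nvar aJ)) (RSqrt (rvar rMax)))))
      (Seq (for_loop aJ aCols (RSet 3 (nvar aJ) (RCell rRows (NAdd (nvar aRow) (nvar aJ)))))
        (Seq (rassign rBest (RConst (- 1))) (Seq try_candidate (Seq (rassign rTau (RConst (r * r)))
          (Seq tc_loop (for_loop aJ aCols (RSet 3 (nvar aJ) (RCell rSol (nvar aJ)))))))))))"

definition search_time :: "nat \<Rightarrow> nat \<Rightarrow> nat \<Rightarrow> nat" where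
  "search_time n d B = (n + 1) * (2 * N + 3 * (n * d) + 3 * n + B + n * (4 * d + 6 * (n + 1) + 10) + 3 * d + 27)
    + 3 * (n * d) + n * (4 * d + 6 * (n + 1) + 10) + 9 * d + 20"

text \<open>The \<open>else\<close> branch in \<open>v\<close> describes the cells beyond the
  matrix, so that \<open>v\<close> is literally \<open>flat_row d\<close> of the whole array after
  the division. Knowing that the output is \<open>v i\<close> or satisfies some \<open>G k\<close>
  later makes it a unit vector.\<close>

lemma wp_search:
  fixes G :: "nat \<Rightarrow> real vec \<Rightarrow> bool"
  assumes s: "nats s aRows 0 = n" "nats s aCols 0 = d" "nats s aPos 0 = n * d" "nats s aRow 0 = i * d"
      "i < n"
    and d: "d \<ge> 1"
    and v: "v = flat_row d (\<lambda>k. if k < n * d then reals s 0 k / sqrt (reals s rMax 0) else reals s rRows k)"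
    and F: "F = vec_score r (n + 1) n v"
    and P: "\<And>k. k < n + 1 \<Longrightarrow> \<exists>t0 s0. exec P (tc_input n d v (\<lambda>_. 1) (r ^ (2 * k + 2))) t0 s0 \<and>
      t0 \<le> B \<and> G k (output_vec d s0)"
  shows "wp search s (\<lambda>t s'. t \<le> search_time n d B \<and>
    (output_vec d s' = v i \<or> (\<exists>k<n + 1. G k (output_vec d s'))) \<and> F (v i) \<le> F (output_vec d s') \<and>
    (\<forall>k<n + 1. \<exists>y. G k y \<and> F y \<le> F (output_vec d s')))" (is "wp _ _ ?Q")
proof -
  let ?f1 = "for_loop aJ aSize (RSet rRows (nvar aJ) (RDiv (RCell 0 (nvar aJ)) (RSqrt (rvar rMax))))"
  let ?f2 = "for_loop aJ aCols (RSet 3 (nvar aJ) (RCell rRows (NAdd (nvar aRow) (nvar aJ))))"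
  let ?f3 = "for_loop aJ aCols (RSet 3 (nvar aJ) (RCell rSol (nvar aJ)))"
  let ?c6 = "Seq (rassign rTau (RConst (r * r))) (Seq tc_loop ?f3)"
  let ?c4 = "Seq (rassign rBest (RConst (- 1))) (Seq try_candidate ?c6)"
  let ?K = "n + 1"
  let ?V = "\<lambda>k. if k < n * d then reals s 0 k / sqrt (reals s rMax 0) else reals s rRows k"
  let ?s0 = "nset aLevels 0 (n + 1) (nset aSize 0 (n * d) s)"
  let ?T2 = "n * (4 * d + 6 * ?K + 10) + 3 * d + 8"
  let ?T3 = "?K * (2 * N + 3 * (n * d) + 3 * n + B + n * (4 * d + 6 * ?K + 10) + 3 * d + 27) + 2"
  have idx: "i * d + j < n * d" if "j < d" for j
  proof -
    have "i * d + j < Suc i * d" using that by simp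
    also have "\<dots> \<le> n * d" using s(5) by (intro mult_le_mono1) simp
    finally show ?thesis .
  qed
  have f1: "wp ?f1 ?s0 (\<lambda>t u. t \<le> 3 * (n * d) + 2 \<and>
      reals u rRows = (\<lambda>j. if j < n * d then reals s 0 j / sqrt (reals s rMax 0) else reals ?s0 rRows j))"
    by (rule wp_fill) (use s in \<open>auto simp: frame_def\<close>)
  have "wp (Seq ?f1 (Seq ?f2 ?c4)) ?s0 (\<lambda>t'. ?Q (2 + t'))"
    unfolding wp_Seq[of ?f1]
  proof (rule wp_conseq[OF f1])
    fix t1 s1
    assume s1: "t1 \<le> 3 * (n * d) + 2 \<and>
        reals s1 rRows = (\<lambda>j. if j < n * d then reals s 0 j / sqrt (reals s rMax 0) else reals ?s0 rRows j)"
      and fr1: "frame (nmods ?f1) (rmods ?f1) ?s0 s1"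
    have e1: "nats s1 aRows 0 = n" "nats s1 aCols 0 = d" "nats s1 aSize 0 = n * d" "nats s1 aLevels 0 = ?K"
      "nats s1 aRow 0 = i * d" "reals s1 rRows = ?V"
      using fr1 s s1 by (auto simp: frame_def)
    have f2: "wp ?f2 s1 (\<lambda>t u. t \<le> 3 * d + 2 \<and>
        reals u 3 = (\<lambda>j. if j < d then reals s1 rRows (i * d + j) else reals s1 3 j))"
      by (rule wp_fill) (use e1 in \<open>auto simp: frame_def\<close>)
    show "wp (Seq ?f2 ?c4) s1 (\<lambda>t'. ?Q (2 + (t1 + t')))"
      unfolding wp_Seq[of ?f2]
    proof (rule wp_conseq[OF f2])
      fix t2 s2
      assume s2: "t2 \<le> 3 * d + 2 \<and>
          reals s2 3 = (\<lambda>j. if j < d then reals s1 rRows (i * d + j) else reals s1 3 j)"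
        and fr2: "frame (nmods ?f2) (rmods ?f2) s1 s2"
      let ?s3 = "rset rBest 0 (- 1) s2"
      have e3: "nats ?s3 aRows 0 = n" "nats ?s3 aCols 0 = d" "nats ?s3 aLevels 0 = ?K"
        "nats ?s3 aSize 0 = n * d" "reals ?s3 rRows = ?V"
        using fr2 e1 by (auto simp: frame_def)
      have out3: "output_vec d ?s3 = v i"
        unfolding v output_vec_def flat_row_def using s2 e1 idx by (intro eq_vecI) auto
      have Fout: "vec_score r ?K n (flat_row d (reals ?s3 rRows)) (v i) = F (v i)"
        unfolding F e3(5) v ..
      have "wp (Seq try_candidate ?c6) ?s3 (\<lambda>t'. ?Q (2 + (t1 + (t2 + (1 + t')))))"
        unfolding wp_Seq[of try_candidate]
      proof (rule wp_conseq[OF wp_try_candidate[OF e3(1-3)]])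
        fix t4 s4
        assume s4: "t4 \<le> ?T2 \<and>
          (if reals ?s3 rBest 0 < vec_score r ?K n (flat_row d (reals ?s3 rRows)) (output_vec d ?s3)
           then reals s4 rBest 0 = vec_score r ?K n (flat_row d (reals ?s3 rRows)) (output_vec d ?s3) \<and>
             vec d (reals s4 rSol) = output_vec d ?s3
           else reals s4 rBest 0 = reals ?s3 rBest 0 \<and> vec d (reals s4 rSol) = vec d (reals ?s3 rSol))"
          and fr4: "frame (nmods try_candidate) (rmods try_candidate) ?s3 s4"
        have "F (v i) \<ge> 0" unfolding F by (rule vec_score_nonneg)
        then have best: "reals s4 rBest 0 = F (v i)" "vec d (reals s4 rSol) = v i"
          using s4 unfolding out3 Fout by (simp_all split: if_splits)
        let ?s5 = "rset rTau 0 (r * r) s4"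
        have e5: "nats ?s5 aRows 0 = n" "nats ?s5 aCols 0 = d" "nats ?s5 aSize 0 = n * d"
          "nats ?s5 aLevels 0 = ?K" "reals ?s5 rTau 0 = r * r"
          "reals ?s5 rRows = ?V" "vec d (reals ?s5 rSol) = v i" "reals ?s5 rBest 0 = F (v i)"
          using fr4 e3 best by (auto simp: frame_def)
        have v5: "flat_row d (reals ?s5 rRows) = v" unfolding e5(6) v ..
        have "wp (Seq tc_loop ?f3) ?s5 (\<lambda>t'. ?Q (2 + (t1 + (t2 + (1 + (t4 + (1 + t')))))))"
          unfolding wp_Seq[of tc_loop]
        proof (rule wp_conseq[OF wp_tc_loop[where F = F and B = B and G = G, OF e5(1-5) d, unfolded v5]])
          fix t6 s6
          assume s6: "t6 \<le> ?T3 \<and>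
              (vec d (reals s6 rSol) = vec d (reals ?s5 rSol) \<or> (\<exists>k<?K. G k (vec d (reals s6 rSol)))) \<and>
              F (vec d (reals ?s5 rSol)) \<le> F (vec d (reals s6 rSol)) \<and>
              (\<forall>k<?K. \<exists>y. G k y \<and> F y \<le> F (vec d (reals s6 rSol)))"
            and fr6: "frame (nmods tc_loop) (rmods tc_loop) ?s5 s6"
          have e6: "nats s6 aCols 0 = d" using fr6 e5 by (auto simp: frame_def)
          have "wp ?f3 s6 (\<lambda>t u. t \<le> 3 * d + 2 \<and>
              reals u 3 = (\<lambda>j. if j < d then reals s6 rSol j else reals s6 3 j))"
            by (rule wp_fill) (use e6 in \<open>auto simp: frame_def\<close>)
          then show "wp ?f3 s6 (\<lambda>t'. ?Q (2 + (t1 + (t2 + (1 + (t4 + (1 + (t6 + t'))))))))"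
          proof (rule wp_mono)
            fix t7 and s7 :: mem
            assume s7: "t7 \<le> 3 * d + 2 \<and>
              reals s7 3 = (\<lambda>j. if j < d then reals s6 rSol j else reals s6 3 j)"
            then have out: "output_vec d s7 = vec d (reals s6 rSol)"
              unfolding output_vec_def by (intro eq_vecI) auto
            have "2 + (t1 + (t2 + (1 + (t4 + (1 + (t6 + t7)))))) \<le> search_time n d B"
              using s1 s2 s4 s6 s7 unfolding search_time_def by linarith
            then show "?Q (2 + (t1 + (t2 + (1 + (t4 + (1 + (t6 + t7))))))) s7"
              using s6 unfolding out e5(7) by blast
          qed
        qed (use F e5 P in auto)
        then show "wp ?c6 s4 (\<lambda>t'. ?Q (2 + (t1 + (t2 + (1 + (t4 + t'))))))"
          by simp
      qed
      then show "wp ?c4 s2 (\<lambda>t'. ?Q (2 + (t1 + (t2 + t'))))"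
        by simp
    qed
  qed
  then show ?thesis
    using s unfolding search_def by simp
qed

section \<open>The complete algorithm and its running time\<close>

definition solver :: com where
  "solver = Seq (nassign aRows (nvar 0)) (Seq (nassign aCols (NCell 0 (NConst 1)))
    (Seq max_row (If (RLess (RConst 0) (rvar rMax)) search (RSet 3 (NConst 0) (RConst 1)))))"

definition solver_time :: "nat \<Rightarrow> nat \<Rightarrow> nat \<Rightarrow> nat" where
  "solver_time n d B = n * (4 * d + 8) + 6 + search_time n d B"

lemma wp_solver:
  assumes p: "p > 2" and r: "r = level_base p"
    and n: "n \<ge> 2" and d: "d \<ge> 1" and A: "A \<in> carrier_mat n d"
    and \<alpha>: "\<alpha> \<in> {0<..1}" and \<beta>: "\<beta> \<in> {0<..1}"
    and P: "\<And>v w \<tau>. tc_instance n d v w \<tau> \<Longrightarrow>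
      \<exists>t s. exec P (tc_input n d v w \<tau>) t s \<and> t \<le> B \<and> tc_approx \<alpha> \<beta> n d v w \<tau> (output_vec d s)"
    and \<theta>: "0 < \<theta>" "\<theta> \<le> (1/144 * (\<alpha> powr (p/2 - 1) * \<beta> / ln n)) powr (1 / p)"
  shows "wp solver (norm_input n d A) (\<lambda>t s. t \<le> solver_time n d B \<and> norm_approx 2 p \<theta> A (output_vec d s))"
    (is "wp _ _ ?Q")
proof -
  let ?s0 = "nset aCols 0 d (nset aRows 0 n (norm_input n d A))"
  let ?If = "If (RLess (RConst 0) (rvar rMax)) search (RSet 3 (NConst 0) (RConst 1))"
  have idx: "i * d + j < n * d" if "i < n" "j < d" for i j
  proof -
    have "i * d + j < Suc i * d" using that by simp
    also have "\<dots> \<le> n * d" using that by (intro mult_le_mono1) simp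
    finally show ?thesis .
  qed
  have A0: "reals ?s0 0 (i * d + j) = A $$ (i, j)" if "i < n" "j < d" for i j
    using that idx by (simp add: norm_input_def input_mem_def)
  have R: "(\<Sum>j<d. (reals ?s0 0 (i * d + j))\<^sup>2) = (lp_norm 2 (row A i))\<^sup>2" if "i < n" for i
    using that A A0 by (simp add: lp_norm_2 sum_nonneg)
  have "wp (Seq max_row ?If) ?s0 (\<lambda>t. ?Q (2 + t))"
    unfolding wp_Seq[of max_row]
  proof (rule wp_conseq[OF wp_max_row[where n = n and d = d]])
    fix t1 and s1 :: mem
    let ?m = "reals s1 rMax 0"
    assume s1: "t1 \<le> n * (4 * d + 8) + 2 \<and> nats s1 aPos 0 = n * d \<and> 0 \<le> ?m \<and>
        (\<forall>i<n. (\<Sum>j<d. (reals ?s0 0 (i * d + j))\<^sup>2) \<le> ?m) \<and>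
        (?m = 0 \<or> (\<exists>i<n. nats s1 aRow 0 = i * d \<and> ?m = (\<Sum>j<d. (reals ?s0 0 (i * d + j))\<^sup>2)))"
      and fr: "frame (nmods max_row) (rmods max_row) ?s0 s1"
    have e1: "nats s1 aRows 0 = n" "nats s1 aCols 0 = d" "reals s1 0 = reals ?s0 0"
      "reals s1 3 = (\<lambda>_. 0)"
      using fr by (auto simp: frame_def norm_input_def input_mem_def)
    have le: "lp_norm 2 (row A i) \<le> sqrt ?m" if "i < n" for i
      using s1 R[OF that] that by (metis real_le_rsqrt)
    show "wp ?If s1 (\<lambda>t. ?Q (2 + (t1 + t)))"
    proof (cases "?m > 0")
      case False
      \<comment> \<open>The matrix is zero and array 3 is still zero, so the single write makes the
        output the first standard basis vector.\<close>
      then have m0: "?m = 0" using s1 by simp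
      have "row A i = 0\<^sub>v d" if "i < n" for i
        using le[OF that] m0 lp_norm_2_pos[of "row A i" d] A by fastforce
      moreover have "output_vec d (rset 3 0 1 s1) $ 0 \<noteq> 0\<^sub>v d $ 0"
        using d by (simp add: output_vec_def)
      then have "output_vec d (rset 3 0 1 s1) \<noteq> 0\<^sub>v d" by auto
      moreover have "output_vec d (rset 3 0 1 s1) \<in> carrier_vec d"
        by (simp add: output_vec_def)
      ultimately have "norm_approx 2 p \<theta> A (output_vec d (rset 3 0 1 s1))"
        using \<theta> d by (intro norm_approx_zero_rows[OF A])
      then show ?thesis using m0 s1 by (simp add: solver_time_def)
    next
      case True
      then obtain i where i: "i < n" "nats s1 aRow 0 = i * d" "?m = (lp_norm 2 (row A i))\<^sup>2"
        using s1 R by auto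
      define v where "v = flat_row d (\<lambda>k. if k < n * d then reals s1 0 k / sqrt ?m else reals s1 rRows k)"
      have v: "v k = (1 / sqrt ?m) \<cdot>\<^sub>v row A k" if "k < n" for k
        using that A A0 e1 idx by (intro eq_vecI) (auto simp: v_def flat_row_def)
      have vi: "lp_norm 2 (v i) = 1"
        using i True by (simp add: v lp_norm_smult) (simp add: lp_norm_2 sum_nonneg)
      have inst: "tc_instance n d v (\<lambda>_. 1) (level_base p ^ (2 * k + 2))" for k
      proof -
        have "level_base p \<le> 1" using p powr_mono[of "- 1 / p" 0 2] by (simp add: level_base_def)
        then have "level_base p ^ (2 * k + 2) \<in> {0..1}"
          using level_base_pos[of p] power_le_one[of "level_base p" "2 * k + 2"] by simp
        moreover have "lp_norm 2 (v j) \<le> 1" if "j < n" for j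
          using le[OF that] True by (simp add: v[OF that] lp_norm_smult)
        ultimately show ?thesis using n d by (auto simp: tc_instance_def v_def flat_row_def)
      qed
      define F where "F = vec_score r (n + 1) n v"
      have vi_unit: "v i \<in> unit_sphere d"
        using vi by (simp add: unit_sphere_def v_def flat_row_def)
      \<comment> \<open>The inner product of \<open>v i\<close> with itself is 1, so level 0 of that
        one entry already contributes 1.\<close>
      have Fi: "1 \<le> F (v i)"
      proof -
        have "v i \<bullet> v i = (lp_norm 2 (v i))\<^sup>2"
          by (simp add: lp_norm_2 sum_nonneg scalar_prod_def atLeast0LessThan power2_eq_square)
        then have "1 \<le> level_score r (n + 1) \<bar>v i \<bullet> v i\<bar>"
          using vi p r level_score_one[of p n] by simp
        also have "\<dots> \<le> F (v i)"
          unfolding F_def vec_score_def using i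
          by (intro member_le_sum) (auto simp: level_score_nonneg)
        finally show ?thesis .
      qed
      have "wp search s1 (\<lambda>t s'. t \<le> search_time n d B \<and>
          (output_vec d s' = v i \<or> (\<exists>k<n + 1. tc_approx \<alpha> \<beta> n d v (\<lambda>_. 1) (r ^ (2 * k + 2)) (output_vec d s'))) \<and>
          F (v i) \<le> F (output_vec d s') \<and>
          (\<forall>k<n + 1. \<exists>y. tc_approx \<alpha> \<beta> n d v (\<lambda>_. 1) (r ^ (2 * k + 2)) y \<and> F y \<le> F (output_vec d s')))"
        by (rule wp_search[OF e1(1,2) _ i(2,1) d v_def F_def]) (use s1 P inst r in auto)
      then have "wp search s1 (\<lambda>t. ?Q (2 + (t1 + (t + 1))))"
      proof (rule wp_mono)
        fix t and s' :: mem
        let ?x = "output_vec d s'"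
        assume s': "t \<le> search_time n d B \<and>
          (?x = v i \<or> (\<exists>k<n + 1. tc_approx \<alpha> \<beta> n d v (\<lambda>_. 1) (r ^ (2 * k + 2)) ?x)) \<and>
          F (v i) \<le> F ?x \<and>
          (\<forall>k<n + 1. \<exists>y. tc_approx \<alpha> \<beta> n d v (\<lambda>_. 1) (r ^ (2 * k + 2)) y \<and> F y \<le> F ?x)"
        have x: "?x \<in> unit_sphere d" using s' vi_unit by (auto simp: tc_approx_def)
        have "1/144 * (\<alpha> powr (p/2 - 1) * \<beta> / ln n) * power_sum p n v u \<le> power_sum p n v ?x"
          if "u \<in> unit_sphere d" for u
          using s' Fi that r
          by (intro power_sum_best_candidate[OF p n \<alpha> \<beta> inst F_def[unfolded r]]) auto
        then have "norm_approx 2 p \<theta> A ?x"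
          using True \<theta> \<alpha> \<beta> n by (intro norm_approx_of_power_sum[OF A d x p _ v]) auto
        then show "?Q (2 + (t1 + (t + 1))) s'"
          using s1 s' by (simp add: solver_time_def)
      qed
      then show ?thesis using True by simp
    qed
  qed (auto simp: norm_input_def input_mem_def)
  then show ?thesis
    unfolding solver_def wp_Seq[of "nassign a e" for a e] wp_NSet
    by (simp add: norm_input_def input_mem_def del: wp_Seq wp_If)
qed

text \<open>The running time is monotone in \<open>n\<close> and \<open>d\<close>; \<open>T'\<close>
  arises by replacing both by their sum.\<close>

lemma solver_time_poly: "\<exists>T' :: nat poly. \<forall>n d. solver_time n d (poly T (n + d)) \<le> poly T' (n + d)"
proof -
  define X :: "nat poly" where "X = [:0, 1:]"
  define C :: "nat \<Rightarrow> nat poly" where "C k = [:k:]" for k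
  have X: "poly X m = m" and C: "poly (C k) m = k" for m k by (simp_all add: X_def C_def)
  define T' where "T' = X * (C 4 * X + C 8) + C 6 +
    ((X + C 1) * (C (2 * N) + C 3 * (X * X) + C 3 * X + T + X * (C 4 * X + C 6 * (X + C 1) + C 10) + C 3 * X + C 27)
    + C 3 * (X * X) + X * (C 4 * X + C 6 * (X + C 1) + C 10) + C 9 * X + C 20)"
  have "solver_time n d (poly T (n + d)) \<le> poly T' (n + d)" for n d
    unfolding solver_time_def search_time_def T'_def
    by (simp only: poly_add poly_mult X C) (intro add_mono mult_mono order.refl; simp)
  then show ?thesis by blast
qed

end

theorem theorem17:
  shows "\<exists>c>0. \<forall>p>2. \<forall>\<alpha> \<beta> :: nat \<Rightarrow> nat \<Rightarrow> real.
    (\<forall>n d. \<alpha> n d \<in> {0<..1} \<and> \<beta> n d \<in> {0<..1}) \<longrightarrow>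
    (\<exists>P. poly_time_tc_approx \<alpha> \<beta> P) \<longrightarrow>
    (\<exists>Q. poly_time_norm_approx 2 p
      (\<lambda>n d. c * (\<alpha> n d powr (1/2 - 1/p) * \<beta> n d powr (1/p) / ln (real n) powr (1/p))) Q)"
proof (intro exI[of _ "1/144"] conjI allI impI)
  fix p :: real and \<alpha> \<beta> :: "nat \<Rightarrow> nat \<Rightarrow> real"
  assume p: "p > 2" and \<alpha>\<beta>: "\<forall>n d. \<alpha> n d \<in> {0<..1} \<and> \<beta> n d \<in> {0<..1}"
    and "\<exists>P. poly_time_tc_approx \<alpha> \<beta> P"
  then obtain P and T :: "nat poly" where P: "\<And>n d v w \<tau>. tc_instance n d v w \<tau> \<Longrightarrow>
      \<exists>t s. exec P (tc_input n d v w \<tau>) t s \<and> t \<le> poly T (n + d) \<and>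
        tc_approx (\<alpha> n d) (\<beta> n d) n d v w \<tau> (output_vec d s)"
    unfolding poly_time_tc_approx_def by blast
  obtain N where "used P \<subseteq> {..<N}" using finite_used[of P] finite_nat_bounded by blast
  \<comment> \<open>The offset 4 in the locale reserves arrays 0 to 3 even if \<open>P\<close>
    mentions none of them.\<close>
  then interpret tc_reduction N "level_base p" P by unfold_locales auto
  obtain T' :: "nat poly" where T': "\<And>n d. solver_time n d (poly T (n + d)) \<le> poly T' (n + d)"
    using solver_time_poly by blast
  let ?\<theta> = "\<lambda>n d. 1/144 * (\<alpha> n d powr (1/2 - 1/p) * \<beta> n d powr (1/p) / ln (real n) powr (1/p))"
  have "\<exists>t s. exec solver (norm_input n d A) t s \<and> t \<le> poly T' (n + d) \<and>
      norm_approx 2 p (?\<theta> n d) A (output_vec d s)"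
    if n: "n \<ge> 2" and d: "d \<ge> 1" and A: "A \<in> carrier_mat n d" for n d and A :: "real mat"
  proof -
    have ab: "\<alpha> n d \<in> {0<..1}" "\<beta> n d \<in> {0<..1}" using \<alpha>\<beta> by auto
    have "(p/2 - 1) * (1/p) = 1/2 - 1/p" using p by (simp add: field_simps)
    then have eq: "(1/144 * (\<alpha> n d powr (p/2 - 1) * \<beta> n d / ln n)) powr (1/p) =
        (1/144) powr (1/p) * (\<alpha> n d powr (1/2 - 1/p) * \<beta> n d powr (1/p) / ln n powr (1/p))"
      using ab n by (simp only: powr_mult powr_divide powr_powr)
    \<comment> \<open>The constant must not depend on \<open>p\<close>. As \<open>1/p < 1\<close>,
      the \<open>p\<close>-th root of 1/144 is at least 1/144 itself.\<close>
    have "(1/144) powr 1 \<le> (1/144 :: real) powr (1/p)"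
      using p by (intro powr_mono') auto
    then have "?\<theta> n d \<le> (1/144 * (\<alpha> n d powr (p/2 - 1) * \<beta> n d / ln n)) powr (1/p)"
      unfolding eq by (intro mult_right_mono) auto
    moreover have "0 < ?\<theta> n d" using ab n by simp
    ultimately have "wp solver (norm_input n d A) (\<lambda>t s. t \<le> solver_time n d (poly T (n + d)) \<and>
        norm_approx 2 p (?\<theta> n d) A (output_vec d s))"
      using P by (intro wp_solver[OF p refl n d A ab]) auto
    then show ?thesis unfolding wp_def using T' order.trans by blast
  qed
  then have "poly_time_norm_approx 2 p ?\<theta> solver"
    unfolding poly_time_norm_approx_def by blast
  then show "\<exists>Q. poly_time_norm_approx 2 p ?\<theta> Q" by blast
qed simp

end
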